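(* The following homotopy equivalences hold: (1) for all integers $n\ge k\ge 2$, $$\Delta_k^t(\mathcal{G}_{2\times n})\simeq \bigvee_{\binom{n-1}{k-1}}\mathbb{S}^{2n-2k};$$ (2) for all integers $n\ge 2$, $$\Delta_3^t(\mathcal{G}_{3\times n})\simeq \bigvee_{\binom{2n-2}{2}}\mathbb{S}^{3n-6}.$$
   Context: For $m,n\ge 1$, $\mathcal{G}_{m\times n}$ denotes the $m\times n$ grid graph: vertices are pairs (row $i\in\{1,\dots,m\}$, column $j\in\{1,\dots,n\}$), two vertices being adjacent iff they agree in one coordinate and differ by exactly $1$ in the other. For a finite simple graph $G$ and $k\ge1$, the total $k$-cut complex $\Delta_k^t(G)$ is the simplicial complex whose facets are the complements in $V(G)$ of the independent sets of $G$ of size $k$; equivalently, $\sigma\subseteq V(G)$ is a face iff $V(G)\setminus\sigma$ contains an independent set of size $k$. $\bigvee_{N}\mathbb{S}^d$ denotes a wedge of $N$ spheres of dimension $d$, and $\simeq$ denotes homotopy equivalence (of geometric realizations). *)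

theory Defs
  imports "HOL-Analysis.Analysis"
begin

section \<open>Grid graphs and total cut complexes\<close>

text \<open>
  A finite simple graph is given by a finite vertex set \<open>V\<close> and a symmetric, irreflexive
  adjacency relation \<open>E\<close>, of which only the restriction to \<open>V\<close> matters.
\<close>

definition grid_vertices :: "nat \<Rightarrow> nat \<Rightarrow> (nat \<times> nat) set" where
  "grid_vertices m n = {1..m} \<times> {1..n}"

definition grid_adj :: "nat \<times> nat \<Rightarrow> nat \<times> nat \<Rightarrow> bool" where
  "grid_adj u v \<longleftrightarrow>
     (fst u = fst v \<and> (snd u = snd v + 1 \<or> snd v = snd u + 1)) \<or>
     (snd u = snd v \<and> (fst u = fst v + 1 \<or> fst v = fst u + 1))"

lemma finite_grid_vertices: "finite (grid_vertices m n)"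
  by (simp add: grid_vertices_def)

lemma symp_grid_adj: "symp grid_adj"
  by (auto simp: symp_def grid_adj_def)

lemma irreflp_grid_adj: "irreflp grid_adj"
  by (auto simp: irreflp_def grid_adj_def)

definition independent_set :: "'a set \<Rightarrow> ('a \<Rightarrow> 'a \<Rightarrow> bool) \<Rightarrow> 'a set \<Rightarrow> bool" where
  "independent_set V E S \<longleftrightarrow> S \<subseteq> V \<and> (\<forall>u\<in>S. \<forall>v\<in>S. \<not> E u v)"

text \<open>An abstract simplicial complex is represented by its set of faces, the empty face included.\<close>

definition total_cut_complex :: "nat \<Rightarrow> 'a set \<Rightarrow> ('a \<Rightarrow> 'a \<Rightarrow> bool) \<Rightarrow> 'a set set" where
  "total_cut_complex k V E =
     {\<sigma>. \<exists>S. independent_set V E S \<and> card S = k \<and> \<sigma> \<subseteq> V - S}"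

lemma mem_total_cut_complex_iff:
  "\<sigma> \<in> total_cut_complex k V E \<longleftrightarrow>
     \<sigma> \<subseteq> V \<and> (\<exists>S \<subseteq> V - \<sigma>. independent_set V E S \<and> card S = k)"
proof -
  have *: "S \<subseteq> V \<Longrightarrow> \<sigma> \<subseteq> V - S \<longleftrightarrow> \<sigma> \<subseteq> V \<and> S \<subseteq> V - \<sigma>" for S
    by blast
  have "independent_set V E S \<and> card S = k \<and> \<sigma> \<subseteq> V - S \<longleftrightarrow>
          \<sigma> \<subseteq> V \<and> S \<subseteq> V - \<sigma> \<and> independent_set V E S \<and> card S = k" for S
    using *[of S] by (cases "S \<subseteq> V") (simp_all add: independent_set_def conj_ac)
  then show ?thesis
    unfolding total_cut_complex_def by simp
qed


section \<open>Geometric realization\<close>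

text \<open>
  Points are barycentric coordinate functions whose support is a face. The topology is that of
  pointwise convergence; for a complex on a finite vertex set, the only case used here, this is
  the usual topology of the realization as a subspace of the simplex spanned by all vertices.
\<close>

definition geometric_realization :: "'a set set \<Rightarrow> ('a \<Rightarrow> real) topology" where
  "geometric_realization K =
     subtopology (powertop_real UNIV)
       {x. (\<forall>v. 0 \<le> x v) \<and> {v. x v \<noteq> 0} \<in> K \<and> (\<Sum>v | x v \<noteq> 0. x v) = 1}"


section \<open>Wedge sums\<close>

text \<open>
  The wedge of the pointed spaces \<open>(X i, p i)\<close>, \<open>i \<in> I\<close>, is the quotient of their disjoint union
  that identifies all base points. The common base point is \<open>None\<close>, and \<open>wedge_proj p\<close> is the
  quotient map; \<open>None\<close> is added to the carrier so that the empty wedge is a point.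
\<close>

definition wedge_proj :: "('i \<Rightarrow> 'a) \<Rightarrow> 'i \<times> 'a \<Rightarrow> ('i \<times> 'a) option" where
  "wedge_proj p = (\<lambda>(i, x). if x = p i then None else Some (i, x))"

definition wedge :: "('i \<Rightarrow> 'a topology) \<Rightarrow> ('i \<Rightarrow> 'a) \<Rightarrow> 'i set \<Rightarrow> ('i \<times> 'a) option topology" where
  "wedge X p I =
     topology (\<lambda>U. U \<subseteq> insert None (wedge_proj p ` topspace (sum_topology X I)) \<and>
                   openin (sum_topology X I)
                     {z \<in> topspace (sum_topology X I). wedge_proj p z \<in> U})"

lemma istopology_wedge:
  fixes X :: "'i \<Rightarrow> 'a topology"
  shows "istopology (\<lambda>U. U \<subseteq> insert None (wedge_proj p ` topspace (sum_topology X I)) \<and>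
                   openin (sum_topology X I)
                     {z \<in> topspace (sum_topology X I). wedge_proj p z \<in> U})"
proof -
  have "istopology (\<lambda>U. U \<subseteq> C \<and> openin S {z \<in> topspace S. f z \<in> U})"
    for C and S :: "('i \<times> 'a) topology" and f :: "'i \<times> 'a \<Rightarrow> ('i \<times> 'a) option"
  proof -
    have 1: "{z \<in> topspace S. f z \<in> U \<inter> V} =
        {z \<in> topspace S. f z \<in> U} \<inter> {z \<in> topspace S. f z \<in> V}" for U V
      by blast
    have 2: "{z \<in> topspace S. f z \<in> \<Union>\<K>} = (\<Union>U\<in>\<K>. {z \<in> topspace S. f z \<in> U})" for \<K>
      by blast
    show ?thesis
      unfolding istopology_def 1 2 by blast
  qed
  then show ?thesis .
qed

lemma openin_wedge:
  "openin (wedge X p I) U \<longleftrightarrow>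
     U \<subseteq> insert None (wedge_proj p ` topspace (sum_topology X I)) \<and>
     openin (sum_topology X I) {z \<in> topspace (sum_topology X I). wedge_proj p z \<in> U}"
  unfolding wedge_def topology_inverse'[OF istopology_wedge] by (rule refl)

lemma topspace_wedge:
  "topspace (wedge X p I) = insert None (wedge_proj p ` topspace (sum_topology X I))"
proof
  show "topspace (wedge X p I) \<subseteq> insert None (wedge_proj p ` topspace (sum_topology X I))"
    by (rule openin_wedge[THEN iffD1, THEN conjunct1]) (rule openin_topspace)
  let ?C = "insert None (wedge_proj p ` topspace (sum_topology X I))"
  have "{z \<in> topspace (sum_topology X I). wedge_proj p z \<in> ?C} = topspace (sum_topology X I)"
    by blast
  then have "openin (sum_topology X I) {z \<in> topspace (sum_topology X I). wedge_proj p z \<in> ?C}"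
    by (metis openin_topspace)
  then have "openin (wedge X p I) ?C"
    by (intro openin_wedge[THEN iffD2] conjI subset_refl)
  then show "?C \<subseteq> topspace (wedge X p I)"
    by (rule openin_subset)
qed

lemma quotient_map_wedge_proj:
  assumes "I \<noteq> {}" and "\<And>i. i \<in> I \<Longrightarrow> p i \<in> topspace (X i)"
  shows "quotient_map (sum_topology X I) (wedge X p I) (wedge_proj p)"
proof -
  obtain i where "i \<in> I"
    using assms(1) by blast
  then have "(i, p i) \<in> topspace (sum_topology X I)"
    using assms(2) by simp
  moreover have "wedge_proj p (i, p i) = None"
    by (simp add: wedge_proj_def)
  ultimately have "None \<in> wedge_proj p ` topspace (sum_topology X I)"
    by (metis image_eqI)
  then have C: "topspace (wedge X p I) = wedge_proj p ` topspace (sum_topology X I)"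
    unfolding topspace_wedge by (rule insert_absorb)
  have "openin (sum_topology X I) {z \<in> topspace (sum_topology X I). wedge_proj p z \<in> U}
          \<longleftrightarrow> openin (wedge X p I) U"
    if "U \<subseteq> topspace (wedge X p I)" for U
    using that unfolding openin_wedge[of X p I U] topspace_wedge by (rule iffI[OF conjI conjunct2])
  then show ?thesis
    unfolding quotient_map_def using C by (metis (no_types, lifting))
qed

definition sphere_basepoint :: "nat \<Rightarrow> real" where
  "sphere_basepoint = (\<lambda>j. if j = 0 then 1 else 0)"

lemma sphere_basepoint_in_nsphere: "sphere_basepoint \<in> topspace (nsphere d)"
proof -
  have "(\<Sum>i\<le>d. (sphere_basepoint i)\<^sup>2) = (\<Sum>i\<le>d. if i = 0 then 1 else 0)"
    by (rule sum.cong) (auto simp: sphere_basepoint_def)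
  then show ?thesis
    by (simp add: nsphere sphere_basepoint_def)
qed

definition wedge_of_spheres :: "nat \<Rightarrow> nat \<Rightarrow> (nat \<times> (nat \<Rightarrow> real)) option topology" where
  "wedge_of_spheres N d = wedge (\<lambda>_. nsphere d) (\<lambda>_. sphere_basepoint) {..<N}"

end

theory Submission
  imports Defs
begin

text \<open>
  A set \<open>\<sigma>\<close> is a face of the complex exactly when its complement \<open>S\<close> contains \<open>k\<close> independent
  vertices, so everything is phrased in terms of the complements \<open>S\<close> and their independence
  number \<open>\<alpha>(S)\<close>. The idea is to read off \<open>\<alpha>(S)\<close> column by column, starting with the last column,
  and to stop as soon as some vertex is seen to be irrelevant: toggling that vertex in \<open>S\<close> then
  pairs faces that differ by one vertex, and such pairs can be collapsed away.

  Consider the grid with two rows. If the last column of \<open>S\<close> is empty, it can be dropped. If it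
  is full, then \<open>\<alpha>\<close> drops by exactly one when it is deleted, because an independent set of the
  remaining columns blocks at most one of its two vertices. If it contains a single vertex \<open>z\<close>,
  some largest independent set contains \<open>z\<close>, so the neighbour of \<open>z\<close> in the previous column
  is irrelevant. So a set stays unpaired only while its columns are full or empty. Once \<open>k\<close> has
  dropped to one, the condition is that the rest of \<open>S\<close> is nonempty, and one set with a single
  vertex remains unpaired. Thus an unpaired set consists of \<open>k - 1\<close> full columns and a vertex: its
  size is \<open>2k - 1\<close>, and its complement is a face of dimension \<open>2n - 2k\<close>. The number of unpaired
  sets satisfies Pascal's recursion. With three rows and \<open>k = 3\<close> the same
  scheme works; two adjacent vertices in the last column again lower \<open>\<alpha>\<close> by one, and a full
  last column leaves one unpaired set, so that by induction the number of unpaired sets is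
  \<open>(2n - 2) choose 2\<close>, all of size \<open>5\<close>
  (lemmas \<open>equicritical_tree_grid_2\<close> and \<open>equicritical_tree_grid_3_3\<close>).

  Such a procedure is a decision tree, and the pairing that it produces is acyclic
  (\<open>decision_tree_acyclic_matching\<close>). This is discrete Morse theory: a complex with an acyclic
  matching whose unpaired (critical) faces all have the same dimension \<open>d\<close> is a wedge of
  \<open>d\<close>-spheres, one for each critical face (\<open>acyclic_matching_imp_wedge_of_spheres\<close>). Indeed the
  pairs above dimension \<open>d\<close> can be collapsed, from the top dimension downwards. In what is left
  the critical faces are maximal; without them, everything collapses to a vertex. So up to
  homotopy the complex is a contractible complex \<open>L\<close> with \<open>d\<close>-simplices attached along their
  boundaries, and contracting \<open>L\<close> to a point yields the wedge (\<open>attach_cells_to_contractible\<close>).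
\<close>


section \<open>Homotopy equivalences from quotient maps\<close>

text \<open>
  This is the reason why contracting a contractible subspace does not change the homotopy type.
  The end \<open>h (1, _)\<close> of the homotopy descends to a map from the quotient \<open>W\<close> back to \<open>X\<close>, which
  is a homotopy inverse of \<open>f\<close>: one homotopy is \<open>h\<close> itself, the other is what \<open>h\<close> induces on \<open>W\<close>.
  The latter is continuous since the product of a quotient map with the compact interval is again
  a quotient map.
\<close>

lemma homotopy_equivalent_space_quotient:
  fixes h :: "real \<times> 'a \<Rightarrow> 'a"
  assumes f: "quotient_map X W f"
    and h: "continuous_map (prod_topology (top_of_set {0..1}) X) X h"
    and h0: "\<And>x. x \<in> topspace X \<Longrightarrow> h (0, x) = x"
    and fibre: "\<And>s x y. s \<in> {0..1} \<Longrightarrow> x \<in> topspace X \<Longrightarrow> y \<in> topspace X \<Longrightarrow> f x = f y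
                  \<Longrightarrow> f (h (s, x)) = f (h (s, y))"
    and h1: "\<And>x y. x \<in> topspace X \<Longrightarrow> y \<in> topspace X \<Longrightarrow> f x = f y \<Longrightarrow> h (1, x) = h (1, y)"
  shows "X homotopy_equivalent_space W"
proof -
  let ?I = "top_of_set {0..1::real}"
  have fim: "f ` topspace X = topspace W" and cf: "continuous_map X W f"
    using quotient_imp_surjective_map[OF f] quotient_imp_continuous_map[OF f] by auto
  have cx: "continuous_map X (prod_topology ?I X) (\<lambda>x. (t, x))" if "t \<in> {0..1}" for t
    using that by (simp add: continuous_map_pairedI)
  have ch1: "continuous_map X X (\<lambda>x. h (1, x))"
    using continuous_map_compose[OF cx[of 1] h] by (simp add: o_def)
  obtain g where g: "continuous_map W X g" and gf: "\<And>x. x \<in> topspace X \<Longrightarrow> g (f x) = h (1, x)"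
    by (rule quotient_map_lift_exists[OF f ch1]) (use h1 in blast)+
  have q: "quotient_map (prod_topology ?I X) (prod_topology ?I W) (\<lambda>(s, x). (s, f x))"
  proof (rule quotient_map_prod_right[OF _ _ f])
    show "locally_compact_space ?I"
      by (simp add: compact_imp_locally_compact_space compact_space_subtopology)
    show "Hausdorff_space ?I \<or> regular_space ?I"
      by (simp add: Hausdorff_space_subtopology)
  qed
  have cfh: "continuous_map (prod_topology ?I X) W (f \<circ> h)"
    using continuous_map_compose[OF h cf] .
  have compat: "(f \<circ> h) z = (f \<circ> h) z'"
    if "z \<in> topspace (prod_topology ?I X)" "z' \<in> topspace (prod_topology ?I X)"
      "(\<lambda>(s, x). (s, f x)) z = (\<lambda>(s, x). (s, f x)) z'" for z z'
    using that by (cases z; cases z') (auto intro: fibre)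
  have "\<exists>G. continuous_map (prod_topology ?I W) W G \<and>
          (\<forall>s\<in>{0..1}. \<forall>x\<in>topspace X. G (s, f x) = f (h (s, x)))"
  proof (rule quotient_map_lift_exists[OF q cfh compat])
    fix G
    assume G: "continuous_map (prod_topology ?I W) W G"
      and Gf: "\<And>z. z \<in> topspace (prod_topology ?I X) \<Longrightarrow> G ((\<lambda>(s, x). (s, f x)) z) = (f \<circ> h) z"
    have "G (s, f x) = f (h (s, x))" if "s \<in> {0..1}" "x \<in> topspace X" for s x
      using Gf[of "(s, x)"] that by simp
    with G show ?thesis by blast
  qed
  then obtain G where G: "continuous_map (prod_topology ?I W) W G"
    and Gf': "\<And>s x. s \<in> {0..1} \<Longrightarrow> x \<in> topspace X \<Longrightarrow> G (s, f x) = f (h (s, x))"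
    by blast
  have "homotopic_with (\<lambda>x. True) X X (\<lambda>x. h (0, x)) (\<lambda>x. h (1, x))"
    unfolding homotopic_with_def using h by (intro exI[of _ h]) simp
  then have "homotopic_with (\<lambda>x. True) X X (g \<circ> f) id"
    by (rule homotopic_with_eq[OF homotopic_with_symD]) (simp_all add: gf h0)
  moreover have "homotopic_with (\<lambda>x. True) W W id (f \<circ> g)"
  proof -
    have *: "G (0, w) = w" "G (1, w) = f (g w)" if "w \<in> topspace W" for w
    proof -
      have "w \<in> f ` topspace X" using that fim by simp
      then obtain x where "x \<in> topspace X" "w = f x" by (rule imageE)
      then show "G (0, w) = w" "G (1, w) = f (g w)"
        using Gf'[of 0 x] Gf'[of 1 x] h0[of x] gf[of x] by simp_all
    qed
    have "homotopic_with (\<lambda>x. True) W W (\<lambda>w. G (0, w)) (\<lambda>w. G (1, w))"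
      unfolding homotopic_with_def using G by (intro exI[of _ G]) auto
    then show ?thesis
      by (rule homotopic_with_eq) (simp_all add: *)
  qed
  ultimately show ?thesis
    unfolding homotopy_equivalent_space_def using cf g homotopic_with_symD by blast
qed


section \<open>Realizations of finite complexes\<close>

definition abstract_complex :: "'a set set \<Rightarrow> bool" where
  "abstract_complex K \<longleftrightarrow> finite K \<and> (\<forall>\<sigma>\<in>K. finite \<sigma> \<and> Pow \<sigma> \<subseteq> K)"

text \<open>
  The carrier of the geometric realization; on functions, pointwise convergence is the topology
  of the type class, so that the library on \<open>continuous_on\<close> applies.
\<close>

definition realization :: "'a set set \<Rightarrow> ('a \<Rightarrow> real) set" where
  "realization K = {x. (\<forall>v. 0 \<le> x v) \<and> {v. x v \<noteq> 0} \<in> K \<and> (\<Sum>v | x v \<noteq> 0. x v) = 1}"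

lemma geometric_realization_eq: "geometric_realization K = top_of_set (realization K)"
  by (simp add: geometric_realization_def realization_def euclidean_product_topology)

lemma realizationI:
  assumes "abstract_complex K" "\<And>v. 0 \<le> x v" "\<sigma> \<in> K" "\<And>v. v \<notin> \<sigma> \<Longrightarrow> x v = 0" "sum x \<sigma> = 1"
  shows "x \<in> realization K"
proof -
  have sub: "{v. x v \<noteq> 0} \<subseteq> \<sigma>"
    using assms(4) by auto
  then have "finite \<sigma>" "{v. x v \<noteq> 0} \<in> K"
    using assms(1,3) by (auto simp: abstract_complex_def)
  moreover have "(\<Sum>v | x v \<noteq> 0. x v) = sum x \<sigma>"
    by (rule sum.mono_neutral_left) (use sub calculation in auto)
  ultimately show ?thesis
    using assms by (simp add: realization_def)
qed

lemma realizationE: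
  assumes "abstract_complex K" "x \<in> realization K"
  obtains \<sigma> where "\<sigma> \<in> K" "\<sigma> = {v. x v \<noteq> 0}" "finite \<sigma>" "\<And>v. v \<in> \<sigma> \<longleftrightarrow> 0 < x v" "sum x \<sigma> = 1"
  using assms by (force simp: realization_def abstract_complex_def order_less_le)

lemma realization_sum:
  assumes "abstract_complex K" "x \<in> realization K" "finite V" "{v. x v \<noteq> 0} \<subseteq> V"
  shows "sum x V = 1"
proof -
  have "(\<Sum>v | x v \<noteq> 0. x v) = sum x V"
    by (rule sum.mono_neutral_left) (use assms in auto)
  then show ?thesis using assms by (simp add: realization_def)
qed

lemma continuous_on_Min_image:
  fixes g :: "'b::topological_space \<Rightarrow> 'a \<Rightarrow> real"
  assumes "finite F" "F \<noteq> {}" "\<And>v. v \<in> F \<Longrightarrow> continuous_on S (\<lambda>z. g z v)"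
  shows "continuous_on S (\<lambda>z. Min (g z ` F))"
  using assms
proof (induction rule: finite_ne_induct)
  case (insert v F)
  then have "continuous_on S (\<lambda>z. min (g z v) (Min (g z ` F)))"
    by (intro continuous_on_min) auto
  then show ?case using insert by simp
qed auto


section \<open>Elementary collapses\<close>

lemma abstract_complex_collapse:
  assumes "abstract_complex K"
    and "\<And>\<rho>. \<rho> \<in> K \<Longrightarrow> \<sigma> \<subseteq> \<rho> \<Longrightarrow> \<rho> = \<sigma> \<or> \<rho> = insert e \<sigma>"
  shows "abstract_complex (K - {\<sigma>, insert e \<sigma>})"
  using assms unfolding abstract_complex_def by blast

text \<open>
  A free face \<open>\<sigma>\<close> of \<open>insert e \<sigma>\<close> is pushed in by moving mass uniformly from the vertices of \<open>\<sigma>\<close> to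
  \<open>e\<close> until one of them has no mass left. The amount \<open>m x\<close> that each vertex gives away is the
  smallest coordinate over \<open>\<sigma>\<close>. It vanishes on all faces that do not contain \<open>\<sigma>\<close>, so a single
  formula defines the deformation on the whole realization.
\<close>

lemma elementary_collapse:
  assumes K: "abstract_complex K"
    and \<sigma>: "\<sigma> \<noteq> {}" "e \<notin> \<sigma>" "insert e \<sigma> \<in> K"
    and free: "\<And>\<rho>. \<rho> \<in> K \<Longrightarrow> \<sigma> \<subseteq> \<rho> \<Longrightarrow> \<rho> = \<sigma> \<or> \<rho> = insert e \<sigma>"
  shows "geometric_realization K homotopy_equivalent_space
         geometric_realization (K - {\<sigma>, insert e \<sigma>})"
proof -
  define K' where "K' = K - {\<sigma>, insert e \<sigma>}"
  have K': "abstract_complex K'"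
    unfolding K'_def by (rule abstract_complex_collapse[OF K free])
  have fin: "finite \<sigma>"
    using K \<sigma> by (auto simp: abstract_complex_def)
  define m where "m x = Min (x ` \<sigma>)" for x :: "'a \<Rightarrow> real"
  define w where "w v = (if v \<in> \<sigma> then 1 else if v = e then - real (card \<sigma>) else 0)" for v
  define r where "r = (\<lambda>(t, x) v. x v - t * m x * w v)"
  have m_le: "m x \<le> x v" if "v \<in> \<sigma>" for x v
    using that fin by (simp add: m_def)
  have m_in: "\<exists>v\<in>\<sigma>. x v = m x" for x
  proof -
    have "m x \<in> x ` \<sigma>"
      unfolding m_def using fin \<sigma>(1) by (intro Min_in) auto
    then show ?thesis by force
  qed
  have sumw: "sum w (insert e \<sigma>) = 0"
    using fin \<sigma>(2) by (simp add: w_def)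
  have pos: "x \<in> realization K \<Longrightarrow> 0 \<le> m x" for x
    using m_in[of x] by (auto simp: realization_def) (metis)
  have full: "(\<forall>v. v \<notin> insert e \<sigma> \<longrightarrow> x v = 0) \<and> sum x (insert e \<sigma>) = 1"
    if x: "x \<in> realization K" and "m x > 0" for x
  proof -
    obtain \<rho> where \<rho>: "\<rho> \<in> K" "\<rho> = {v. x v \<noteq> 0}"
      using x K by (blast elim: realizationE)
    have "\<sigma> \<subseteq> \<rho>"
      using m_le[of _ x] \<open>m x > 0\<close> \<rho> by force
    then have "\<rho> \<subseteq> insert e \<sigma>"
      using free \<rho> by blast
    then show ?thesis
      using \<rho> realization_sum[OF K x, of "insert e \<sigma>"] fin by blast
  qed
  have stays: "r (t, x) \<in> realization K" if x: "x \<in> realization K" and t: "t \<in> {0..1}" for t x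
  proof (cases "m x = 0")
    case True
    then show ?thesis using x by (simp add: r_def)
  next
    case False
    then have m: "m x > 0" using pos[OF x] by simp
    have x0: "0 \<le> x v" for v using x by (simp add: realization_def)
    show ?thesis
    proof (rule realizationI[OF K _ \<sigma>(3)])
      have "t * m x \<le> m x" "0 \<le> t * m x" "0 \<le> t * m x * real (card \<sigma>)"
        using t m by (auto simp: mult_left_le_one_le)
      then show "0 \<le> r (t, x) v" for v
        using m_le[of v x] x0[of v] by (cases "v \<in> \<sigma>"; cases "v = e") (simp_all add: r_def w_def)
      show "r (t, x) v = 0" if "v \<notin> insert e \<sigma>" for v
        using that full[OF x m] by (auto simp: r_def w_def)
      have "sum (r (t, x)) (insert e \<sigma>) = sum x (insert e \<sigma>) - t * m x * sum w (insert e \<sigma>)"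
        by (simp only: r_def split sum_subtractf sum_distrib_left)
      then show "sum (r (t, x)) (insert e \<sigma>) = 1"
        using full[OF x m] sumw by simp
    qed
  qed
  have ends: "r (1, x) \<in> realization K'" if x: "x \<in> realization K" for x
  proof -
    have r1: "r (1, x) \<in> realization K" using stays x by simp
    obtain v where v: "v \<in> \<sigma>" "x v = m x" using m_in by blast
    then have "r (1, x) v = 0" by (simp add: r_def w_def)
    with v(1) have "\<not> \<sigma> \<subseteq> {v. r (1, x) v \<noteq> 0}" by blast
    then show ?thesis
      using r1 unfolding realization_def K'_def by auto
  qed
  have fixed: "r (t, x) = x" if x: "x \<in> realization K'" for x t
  proof -
    obtain \<rho> where \<rho>: "\<rho> \<in> K'" "\<rho> = {v. x v \<noteq> 0}"
      using x K' by (blast elim: realizationE)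
    then have "\<not> \<sigma> \<subseteq> \<rho>"
      using free by (auto simp: K'_def)
    then obtain v where "v \<in> \<sigma>" "x v = 0" using \<rho> by blast
    moreover have "x \<in> realization K"
      using x by (auto simp: realization_def K'_def)
    ultimately have "m x = 0" using m_le[of v x] pos[of x] by force
    then show ?thesis by (simp add: r_def)
  qed
  have cont: "continuous_on S r" for S
    unfolding r_def m_def case_prod_unfold
    by (intro continuous_on_coordinatewise_then_product continuous_on_diff continuous_on_mult
        continuous_on_Min_image fin \<sigma>(1) continuous_on_const continuous_on_fst
        continuous_on_product_then_coordinatewise[OF continuous_on_snd] continuous_on_id)
  have sub: "realization K' \<subseteq> realization K"
    by (auto simp: realization_def K'_def)
  show ?thesis
    unfolding geometric_realization_eq K'_def[symmetric]
  proof (rule deformation_retract_imp_homotopy_equivalent_space)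
    have "continuous_map (prod_topology (top_of_set {0..1}) (top_of_set (realization K)))
            (top_of_set (realization K)) r"
      using cont stays by (auto simp: prod_topology_subtopology_eu)
    then have "homotopic_with (\<lambda>x. True) (top_of_set (realization K)) (top_of_set (realization K))
            (\<lambda>x. r (0, x)) (\<lambda>x. r (1, x))"
      unfolding homotopic_with_def by blast
    then show "homotopic_with (\<lambda>x. True) (top_of_set (realization K)) (top_of_set (realization K))
            (\<lambda>x. r (1, x)) id"
      by (rule homotopic_with_eq[OF homotopic_with_symD]) (auto simp: r_def)
    have "continuous_on (realization K) (\<lambda>x. r (1, x))"
      by (rule continuous_on_compose2[OF cont[of UNIV]]) (auto intro!: continuous_intros)
    then show "retraction_maps (top_of_set (realization K)) (top_of_set (realization K'))
            (\<lambda>x. r (1, x)) id"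
      using ends fixed sub by (auto simp: retraction_maps_def)
  qed
qed


section \<open>A closed simplex as a sphere with collapsed boundary\<close>

definition closed_simplex :: "'a set \<Rightarrow> ('a \<Rightarrow> real) set" where
  "closed_simplex F = {x. (\<forall>v. 0 \<le> x v) \<and> (\<forall>v. v \<notin> F \<longrightarrow> x v = 0) \<and> sum x F = 1}"

lemma closed_closed_simplex: "closed (closed_simplex F)"
proof -
  have "closed_simplex F =
      (\<Inter>v. {x. 0 \<le> x v}) \<inter> (\<Inter>v\<in>-F. {x. x v = 0}) \<inter> {x. sum x F = 1}"
    by (auto simp: closed_simplex_def)
  also have "closed \<dots>"
    by (intro closed_Int closed_INT ballI closed_Collect_le closed_Collect_eq continuous_on_sum
        continuous_on_const continuous_on_product_coordinates)
  finally show ?thesis .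
qed

lemma compact_closed_simplex:
  assumes "finite F"
  shows "compact (closed_simplex F)"
proof -
  have "compactin (powertop_real UNIV) (PiE UNIV (\<lambda>_::'a. {0..1::real}))"
    by (simp add: compactin_PiE)
  then have "compact (PiE UNIV (\<lambda>_::'a. {0..1::real}))"
    by (simp add: euclidean_product_topology)
  moreover have "closed_simplex F \<subseteq> PiE UNIV (\<lambda>_. {0..1})"
  proof
    fix x assume x: "x \<in> closed_simplex F"
    have "x v \<le> 1" for v
    proof (cases "v \<in> F")
      case True
      then have "x v \<le> sum x F"
        using x assms by (intro member_le_sum) (auto simp: closed_simplex_def)
      then show ?thesis using x by (simp add: closed_simplex_def)
    qed (use x in \<open>simp add: closed_simplex_def\<close>)
    then show "x \<in> PiE UNIV (\<lambda>_. {0..1})"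
      using x by (auto simp: closed_simplex_def)
  qed
  ultimately show ?thesis
    by (metis Int_absorb1 closed_closed_simplex compact_Int_closed)
qed

text \<open>
  The open simplex is mapped homeomorphically to Euclidean space by \<open>x \<mapsto> y / m\<close>, where \<open>y\<close> is the
  vector from the barycentre to \<open>x\<close>, without its redundant coordinate, and \<open>m\<close> is the smallest
  barycentric coordinate. Inverse stereographic projection then gives the sphere without the base
  point. In the composite the divisions by \<open>m\<close> cancel, and the resulting formula \<open>\<phi>\<close> extends
  continuously to the boundary \<open>m = 0\<close>, which it sends to the base point. For \<open>d = 0\<close> the base
  point is not in the image, which is why the last claim leaves it out.
\<close>

lemma closed_simplex_onto_sphere:
  assumes F: "finite F" and cardF: "card F = Suc d"
  obtains \<phi> :: "('a \<Rightarrow> real) \<Rightarrow> nat \<Rightarrow> real"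
  where "continuous_on (closed_simplex F) \<phi>"
    and "\<phi> ` closed_simplex F \<subseteq> topspace (nsphere d)"
    and "\<And>x. x \<in> closed_simplex F \<Longrightarrow> \<phi> x = sphere_basepoint \<longleftrightarrow> (\<exists>v\<in>F. x v = 0)"
    and "inj_on \<phi> {x \<in> closed_simplex F. \<forall>v\<in>F. x v \<noteq> 0}"
    and "topspace (nsphere d) - {sphere_basepoint} \<subseteq> \<phi> ` closed_simplex F"
proof -
  obtain \<nu> where \<nu>: "bij_betw \<nu> {..d} F"
    using finite_same_card_bij[of "{..d}" F] F cardF by auto
  then have \<nu>F: "\<nu> ` {..d} = F" and inj\<nu>: "inj_on \<nu> {..d}"
    by (auto simp: bij_betw_def)
  have "F \<noteq> {}" using cardF by auto
  define a where "a = 1 / real (d + 1)"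
  have a: "a > 0" "real (d + 1) * a = 1" by (simp_all add: a_def)
  define m where "m x = Min (x ` F)" for x :: "'a \<Rightarrow> real"
  define y where "y x j = x (\<nu> j) - a" for x and j :: nat
  define Q where "Q x = (\<Sum>j=1..d. (y x j)\<^sup>2)" for x
  define \<phi> where "\<phi> x j = (if j = 0 then (Q x - (m x)\<^sup>2) / (Q x + (m x)\<^sup>2)
      else if j \<le> d then 2 * m x * y x j / (Q x + (m x)\<^sup>2) else 0)" for x and j :: nat
  have sphere: "topspace (nsphere d) = {s. (\<Sum>j\<le>d. (s j)\<^sup>2) = 1 \<and> (\<forall>j>d. s j = 0)}"
    by (auto simp: nsphere)
  have split0: "(\<Sum>j\<le>d. g j) = g 0 + (\<Sum>j=1..d. g j)" for g :: "nat \<Rightarrow> real"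
    by (simp add: atMost_atLeast0 sum.atLeast_Suc_atMost)
  have sumF: "sum x F = (\<Sum>j\<le>d. x (\<nu> j))" for x :: "'a \<Rightarrow> real"
    using sum.reindex[OF inj\<nu>, of x] \<nu>F by (simp add: o_def)
  have m_le: "m x \<le> x (\<nu> j)" if "j \<le> d" for x j
    using that F \<nu>F by (auto simp: m_def intro!: Min_le)
  have m_in: "\<exists>j\<le>d. m x = x (\<nu> j)" for x
  proof -
    have "m x \<in> x ` F"
      unfolding m_def using F \<open>F \<noteq> {}\<close> by (intro Min_in) auto
    then show ?thesis by (auto simp: \<nu>F[symmetric])
  qed
  have y0: "y x 0 = - (\<Sum>j=1..d. y x j)" if x: "x \<in> closed_simplex F" for x
  proof -
    have "(\<Sum>j\<le>d. y x j) = sum x F - real (d + 1) * a"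
      by (simp add: sumF y_def sum_subtractf)
    then show ?thesis
      using x a by (simp add: split0[of "y x"] closed_simplex_def)
  qed
  have Q0: "Q x \<ge> 0" for x by (simp add: Q_def sum_nonneg)
  have m0: "m x \<ge> 0" if "x \<in> closed_simplex F" for x
    using that m_in[of x] by (auto simp: closed_simplex_def)
  have den: "Q x + (m x)\<^sup>2 > 0" if x: "x \<in> closed_simplex F" for x
  proof (rule ccontr)
    assume "\<not> ?thesis"
    then have "Q x + (m x)\<^sup>2 = 0"
      using Q0[of x] zero_le_power2[of "m x"] by linarith
    then have "Q x = 0" and m: "m x = 0"
      using Q0[of x] by (auto simp: add_nonneg_eq_0_iff)
    then have yj: "y x j = 0" if "j \<in> {1..d}" for j
      using that by (simp add: Q_def sum_nonneg_eq_0_iff)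
    moreover have "y x 0 = 0" using y0[OF x] yj by simp
    ultimately have "x (\<nu> j) = a" if "j \<le> d" for j
      using that by (cases "j = 0") (auto simp: y_def)
    then show False using m_in[of x] m a by auto
  qed
  have base: "\<phi> x = sphere_basepoint \<longleftrightarrow> m x = 0" if x: "x \<in> closed_simplex F" for x
  proof
    assume "\<phi> x = sphere_basepoint"
    then have "\<phi> x 0 = 1" by (simp add: sphere_basepoint_def)
    then show "m x = 0" using den[OF x] by (simp add: \<phi>_def field_simps)
  next
    assume "m x = 0"
    then show "\<phi> x = sphere_basepoint"
      using den[OF x] by (auto simp: \<phi>_def sphere_basepoint_def)
  qed
  have zero: "m x = 0 \<longleftrightarrow> (\<exists>v\<in>F. x v = 0)" if x: "x \<in> closed_simplex F" for x
  proof
    assume "m x = 0"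
    then show "\<exists>v\<in>F. x v = 0" using m_in[of x] \<nu>F by auto
  next
    assume "\<exists>v\<in>F. x v = 0"
    then obtain j where "j \<le> d" "x (\<nu> j) = 0" using \<nu>F by auto
    then show "m x = 0" using m_le[of j x] m0[OF x] by simp
  qed
  have in_sphere: "\<phi> x \<in> topspace (nsphere d)" if x: "x \<in> closed_simplex F" for x
  proof -
    let ?D = "Q x + (m x)\<^sup>2"
    have "(\<Sum>j\<le>d. (\<phi> x j)\<^sup>2) = (\<phi> x 0)\<^sup>2 + (\<Sum>j=1..d. (\<phi> x j)\<^sup>2)"
      by (rule split0)
    also have "(\<Sum>j=1..d. (\<phi> x j)\<^sup>2) = (\<Sum>j=1..d. (2 * m x / ?D)\<^sup>2 * (y x j)\<^sup>2)"
      by (rule sum.cong) (auto simp: \<phi>_def power_mult_distrib power_divide)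
    also have "\<dots> = (2 * m x / ?D)\<^sup>2 * Q x"
      by (simp add: Q_def sum_distrib_left)
    also have "(\<phi> x 0)\<^sup>2 + \<dots> = ((Q x - (m x)\<^sup>2)\<^sup>2 + 4 * (m x)\<^sup>2 * Q x) / ?D\<^sup>2"
      by (simp add: \<phi>_def power_divide power_mult_distrib add_divide_distrib)
    also have "(Q x - (m x)\<^sup>2)\<^sup>2 + 4 * (m x)\<^sup>2 * Q x = ?D\<^sup>2"
      by (simp add: power2_eq_square algebra_simps)
    also have "?D\<^sup>2 / ?D\<^sup>2 = 1" using den[OF x] by simp
    finally show ?thesis by (auto simp: sphere \<phi>_def)
  qed
  have inj: "x = x'" if x: "x \<in> closed_simplex F" "m x > 0" and x': "x' \<in> closed_simplex F" "m x' > 0"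
    and eq: "\<phi> x = \<phi> x'" for x x'
  proof -
    define z where "z j = y x j / m x" for j
    define c where "c x = (m x)\<^sup>2 / (Q x + (m x)\<^sup>2)" for x
    have c: "\<phi> u 0 = 1 - 2 * c u" if "u \<in> closed_simplex F" for u
      using den[OF that] by (simp add: \<phi>_def c_def field_simps)
    have c_eq: "c x = c x'"
      using c[OF x(1)] c[OF x'(1)] eq by simp
    have "c x > 0" using x den by (simp add: c_def)
    have zc: "\<phi> u j = 2 * (y u j / m u) * c u" if "u \<in> closed_simplex F" "m u > 0" "j \<in> {1..d}" for u j
      using that by (simp add: \<phi>_def c_def power2_eq_square)
    have z': "y x' j / m x' = z j" if "j \<in> {1..d}" for j
      proof -
      have "2 * (y x' j / m x') * c x = 2 * (y x j / m x) * c x"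
        using zc[OF x that] zc[OF x' that] eq c_eq by simp
      then show ?thesis using \<open>c x > 0\<close>
        by (simp add: z_def del: times_divide_eq_left times_divide_eq_right)
    qed
    have yz: "y x j = m x * z j" for j
      using x by (simp add: z_def)
    have yz'1: "y x' j = m x' * z j" if "j \<in> {1..d}" for j
      using z'[OF that] x' by (simp add: field_simps)
    have "y x' 0 = m x' * z 0"
    proof -
      have "y x' 0 = - (\<Sum>j=1..d. m x' * z j)"
        using y0[OF x'(1)] yz'1 by simp
      also have "\<dots> = m x' * (- (\<Sum>j=1..d. z j))"
        by (simp add: sum_distrib_left)
      also have "- (\<Sum>j=1..d. z j) = z 0"
        using y0[OF x(1)] by (simp add: z_def sum_divide_distrib)
      finally show ?thesis .
    qed
    with yz'1 have yz': "y x' j = m x' * z j" if "j \<le> d" for j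
      using that by (cases "j = 0") auto
    \<comment> \<open>A coordinate where \<open>u\<close> is smallest satisfies \<open>m u * (1 - z j) = a\<close>, so \<open>z\<close> determines \<open>m\<close>.\<close>
    have key: "m u' \<le> m u" if u: "m u > 0" "\<And>j. j \<le> d \<Longrightarrow> y u j = m u * z j"
      and u': "m u' > 0" "\<And>j. j \<le> d \<Longrightarrow> y u' j = m u' * z j" for u u'
    proof -
      obtain j where j: "j \<le> d" "m u = u (\<nu> j)" using m_in by blast
      have 1: "m u * (1 - z j) = a"
        using u(2)[OF j(1)] j(2) by (simp add: y_def algebra_simps)
      have 2: "m u' * (1 - z j) \<le> a"
        using u'(2)[OF j(1)] m_le[OF j(1), of u'] by (simp add: y_def algebra_simps)
      have "1 - z j > 0" using 1 u(1) a(1) by (metis zero_less_mult_pos)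
      with 1 2 show ?thesis by (metis mult_le_cancel_right_pos)
    qed
    have "m x = m x'"
      using key[of x x'] key[of x' x] x x' yz yz' by force
    then have "x (\<nu> j) = x' (\<nu> j)" if "j \<le> d" for j
      using yz[of j] yz'[OF that] by (simp add: y_def)
    then have "x v = x' v" if "v \<in> F" for v
      using that by (auto simp: \<nu>F[symmetric])
    moreover have "x v = x' v" if "v \<notin> F" for v
      using that x x' by (simp add: closed_simplex_def)
    ultimately show ?thesis by blast
  qed
  have surj: "s \<in> \<phi> ` closed_simplex F" if s: "s \<in> topspace (nsphere d)" "s \<noteq> sphere_basepoint" for s
  proof -
    have s1: "(s 0)\<^sup>2 + (\<Sum>j=1..d. (s j)\<^sup>2) = 1" and s2: "\<And>j. j > d \<Longrightarrow> s j = 0"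
      using s(1) by (auto simp: sphere split0)
    have "s 0 \<noteq> 1"
    proof
      assume "s 0 = 1"
      then have "s j = 0" if "j \<in> {1..d}" for j
        using s1 that by (simp add: sum_nonneg_eq_0_iff)
      then have "s j = sphere_basepoint j" for j
        using s2[of j] \<open>s 0 = 1\<close> by (cases "j = 0"; cases "j \<le> d") (auto simp: sphere_basepoint_def)
      with s(2) show False by blast
    qed
    moreover have "(s 0)\<^sup>2 \<le> 1"
      using s1 sum_nonneg[of "{1..d}" "\<lambda>j. (s j)\<^sup>2"] by simp
    ultimately have s0: "s 0 < 1"
      by (smt (verit) one_power2 power_strict_mono zero_less_numeral)
    \<comment> \<open>Stereographic projection of \<open>s\<close>; the coordinate \<open>0\<close> is added so that the sum is zero.\<close>
    define z where "z j = (if j = 0 then - (\<Sum>i=1..d. s i / (1 - s 0)) else s j / (1 - s 0))" for j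
    have zsum: "(\<Sum>j\<le>d. z j) = 0"
      by (simp add: split0 z_def)
    define M where "M = Min (z ` {..d})"
    have M_le: "M \<le> z j" if "j \<le> d" for j using that by (simp add: M_def)
    have M_in: "\<exists>j\<le>d. M = z j"
    proof -
      have "M \<in> z ` {..d}" unfolding M_def by (intro Min_in) auto
      then show ?thesis by auto
    qed
    have "M \<le> 0"
    proof (rule ccontr)
      assume "\<not> M \<le> 0"
      then have "(\<Sum>j\<le>d. z j) > 0"
        using M_le by (intro sum_pos) (auto simp: not_le intro: less_le_trans)
      with zsum show False by simp
    qed
    \<comment> \<open>The scale that makes the smallest coordinate \<open>a + \<mu> * M\<close> of the preimage equal to \<open>\<mu>\<close>.\<close>
    define \<mu> where "\<mu> = a / (1 - M)"
    have \<mu>: "\<mu> > 0" "\<mu> * (1 - M) = a" using \<open>M \<le> 0\<close> a by (simp_all add: \<mu>_def)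
    define x where "x v = (if v \<in> F then a + \<mu> * z (inv_into {..d} \<nu> v) else 0)" for v
    have x\<nu>: "x (\<nu> j) = a + \<mu> * z j" if "j \<le> d" for j
      using that inj\<nu> \<nu>F by (auto simp: x_def)
    have lower: "\<mu> \<le> a + \<mu> * z j" if "j \<le> d" for j
    proof -
      have "\<mu> * M \<le> \<mu> * z j" using M_le[OF that] \<mu> by simp
      then show ?thesis using \<mu>(2) by (simp add: algebra_simps)
    qed
    have xF: "x \<in> closed_simplex F"
    proof -
      have "0 \<le> x v" for v
      proof (cases "v \<in> F")
        case True
        then obtain j where "j \<le> d" "v = \<nu> j" using \<nu>F by auto
        then show ?thesis using x\<nu> lower[of j] \<mu> by simp
      qed (simp add: x_def)
      moreover have "sum x F = 1"
      proof -
        have "sum x F = (\<Sum>j\<le>d. a + \<mu> * z j)" by (simp add: sumF x\<nu>)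
        also have "\<dots> = real (d + 1) * a + \<mu> * (\<Sum>j\<le>d. z j)"
          by (simp add: sum.distrib sum_distrib_left)
        finally show ?thesis using a zsum by simp
      qed
      ultimately show ?thesis by (simp add: closed_simplex_def x_def)
    qed
    have mx: "m x = \<mu>"
    proof (rule antisym)
      obtain j where "j \<le> d" "M = z j" using M_in by blast
      then show "m x \<le> \<mu>"
        using m_le[of j x] x\<nu>[of j] \<mu>(2) by (simp add: algebra_simps)
      obtain i where "i \<le> d" "m x = x (\<nu> i)" using m_in by blast
      then show "\<mu> \<le> m x" using x\<nu> lower by simp
    qed
    have yx: "y x j = \<mu> * z j" if "j \<le> d" for j
      using x\<nu>[OF that] by (simp add: y_def)
    define Z where "Z = (\<Sum>j=1..d. (z j)\<^sup>2)"
    have Qx: "Q x = \<mu>\<^sup>2 * Z"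
      by (simp add: Q_def Z_def yx power_mult_distrib sum_distrib_left)
    have "Z = (\<Sum>j=1..d. (s j)\<^sup>2 / (1 - s 0)\<^sup>2)"
      unfolding Z_def by (rule sum.cong) (auto simp: z_def power_divide)
    also have "\<dots> = (1 - (s 0)\<^sup>2) / (1 - s 0)\<^sup>2"
      using s1 by (simp add: sum_divide_distrib[symmetric])
    also have "\<dots> = (1 + s 0) / (1 - s 0)"
      using s0 by (simp add: power2_eq_square divide_simps) (simp add: algebra_simps)
    finally have Z: "Z = (1 + s 0) / (1 - s 0)" .
    have D: "Q x + (m x)\<^sup>2 = \<mu>\<^sup>2 * (2 / (1 - s 0))" "Q x - (m x)\<^sup>2 = \<mu>\<^sup>2 * (2 * s 0 / (1 - s 0))"
      using s0 by (simp_all add: Qx mx Z field_simps)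
    have "\<phi> x j = s j" for j
    proof (cases "j = 0")
      case True
      then show ?thesis
        unfolding \<phi>_def D using \<mu> s0 by (simp add: field_simps)
    next
      case False
      show ?thesis
      proof (cases "j \<le> d")
        case True
        then show ?thesis
          unfolding \<phi>_def D(1) using False \<mu> s0
          by (simp add: yx z_def mx power2_eq_square)
      qed (use False s2 in \<open>simp add: \<phi>_def\<close>)
    qed
    then have "s = \<phi> x" by auto
    then show ?thesis using xF by blast
  qed
  have cont: "continuous_on (closed_simplex F) \<phi>"
  proof (intro continuous_on_coordinatewise_then_product)
    fix j
    have cm: "continuous_on (closed_simplex F) m"
      unfolding m_def
      by (intro continuous_on_Min_image F \<open>F \<noteq> {}\<close> continuous_on_product_then_coordinatewise[OF continuous_on_id])
    have cQ: "continuous_on (closed_simplex F) Q" "continuous_on (closed_simplex F) (\<lambda>x. y x j)"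
      unfolding Q_def y_def
      by (intro continuous_on_sum continuous_on_power continuous_on_diff continuous_on_const
          continuous_on_product_then_coordinatewise[OF continuous_on_id])+
    have "Q x + (m x)\<^sup>2 \<noteq> 0" if "x \<in> closed_simplex F" for x
      using den[OF that] by simp
    then show "continuous_on (closed_simplex F) (\<lambda>x. \<phi> x j)"
      unfolding \<phi>_def by (cases "j = 0"; cases "j \<le> d") (auto intro!: continuous_intros cm cQ)
  qed
  show ?thesis
  proof (rule that[OF cont])
    show "\<phi> ` closed_simplex F \<subseteq> topspace (nsphere d)" using in_sphere by blast
    show "\<phi> x = sphere_basepoint \<longleftrightarrow> (\<exists>v\<in>F. x v = 0)" if "x \<in> closed_simplex F" for x
      using base zero that by simp
    show "inj_on \<phi> {x \<in> closed_simplex F. \<forall>v\<in>F. x v \<noteq> 0}"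
    proof (rule inj_onI)
      fix x x' assume *: "x \<in> {x \<in> closed_simplex F. \<forall>v\<in>F. x v \<noteq> 0}"
        "x' \<in> {x \<in> closed_simplex F. \<forall>v\<in>F. x v \<noteq> 0}" "\<phi> x = \<phi> x'"
      then have "m x > 0" "m x' > 0"
        using zero[of x] zero[of x'] m0[of x] m0[of x'] by (force simp: order_less_le)+
      then show "x = x'" using inj * by blast
    qed
    show "topspace (nsphere d) - {sphere_basepoint} \<subseteq> \<phi> ` closed_simplex F"
      using surj by blast
  qed
qed


section \<open>Attaching cells to a contractible complex\<close>

lemma realization_eq_Union:
  assumes "abstract_complex K"
  shows "realization K = (\<Union>\<sigma>\<in>K. closed_simplex \<sigma>)"
proof
  show "realization K \<subseteq> (\<Union>\<sigma>\<in>K. closed_simplex \<sigma>)"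
    by (auto simp: realization_def closed_simplex_def)
  show "(\<Union>\<sigma>\<in>K. closed_simplex \<sigma>) \<subseteq> realization K"
    using realizationI[OF assms] by (auto simp: closed_simplex_def)
qed

lemma closed_realization:
  assumes "abstract_complex K"
  shows "closed (realization K)"
  using assms closed_closed_simplex
  by (auto simp: realization_eq_Union abstract_complex_def intro!: closed_UN)

text \<open>
  Closed sets are used to recognize the wedge as a quotient, since the realization is covered by
  finitely many compact simplices.
\<close>

lemma closedin_wedge_of_spheres:
  "closedin (wedge_of_spheres N d) C \<longleftrightarrow>
     C \<subseteq> topspace (wedge_of_spheres N d) \<and>
     (\<forall>i<N. closedin (nsphere d)
        {y \<in> topspace (nsphere d). wedge_proj (\<lambda>_. sphere_basepoint) (i, y) \<in> C})"
proof -
  let ?p = "wedge_proj (\<lambda>_::nat. sphere_basepoint)"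
  let ?T = "topspace (wedge_of_spheres N d)"
  have T: "?T = insert None (?p ` ({..<N} \<times> topspace (nsphere d)))"
    by (simp add: wedge_of_spheres_def topspace_wedge)
  have "openin (wedge_of_spheres N d) (?T - C) \<longleftrightarrow>
     (\<forall>i<N. openin (nsphere d) {y \<in> topspace (nsphere d). ?p (i, y) \<in> ?T - C})"
    by (auto simp: wedge_of_spheres_def openin_wedge openin_sum_topology topspace_wedge)
  moreover have "{y \<in> topspace (nsphere d). ?p (i, y) \<in> ?T - C}
      = topspace (nsphere d) - {y \<in> topspace (nsphere d). ?p (i, y) \<in> C}" if "i < N" for i
    using that unfolding T by auto
  ultimately show ?thesis
    unfolding closedin_def by auto
qed

text \<open>
  The map \<open>f\<close> to the wedge collapses \<open>L\<close> and maps each cell by \<open>closed_simplex_onto_sphere\<close>. By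
  \<open>homotopy_equivalent_space_quotient\<close> it suffices to extend the contraction \<open>H\<close> of \<open>L\<close> to a
  homotopy \<open>h\<close> of the whole realization. On a cell, \<open>h\<close> stretches the cell radially from its
  barycentre; points that would leave the cell reach its boundary and spend the rest of the time
  moving along \<open>H\<close>.
\<close>

lemma attach_cells_to_contractible:
  fixes M :: "'a set set"
  assumes M: "abstract_complex M" and L: "abstract_complex L" and LM: "L \<subseteq> M"
    and cells: "bij_betw F {..<N} (M - L)" and cardF: "\<And>i. i < N \<Longrightarrow> card (F i) = Suc d"
    and contr: "contractible_space (geometric_realization L)" and ne: "realization L \<noteq> {}"
  shows "geometric_realization M homotopy_equivalent_space wedge_of_spheres N d"
proof -
  let ?b = "sphere_basepoint"
  let ?p = "wedge_proj (\<lambda>_::nat. ?b)"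
  let ?RM = "realization M" and ?RL = "realization L"
  have F: "F i \<in> M" "F i \<notin> L" "finite (F i)" "F i \<noteq> {}" if "i < N" for i
    using cells that M cardF[OF that] by (auto simp: bij_betw_def abstract_complex_def)
  have F_inj: "F i = F j \<longleftrightarrow> i = j" if "i < N" "j < N" for i j
    using cells that by (auto simp: bij_betw_def inj_on_def)
  have proper: "\<tau> \<in> L" if "i < N" "\<tau> \<subset> F i" for i \<tau>
  proof (rule ccontr)
    assume "\<tau> \<notin> L"
    moreover have "\<tau> \<in> M"
      using F(1)[OF that(1)] that(2) M by (auto simp: abstract_complex_def)
    ultimately have "\<tau> \<in> F ` {..<N}"
      using cells by (auto simp: bij_betw_def)
    then have "card \<tau> = card (F i)" using cardF that(1) by auto
    then show False using psubset_card_mono[OF F(3)[OF that(1)] that(2)] by simp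
  qed
  have RL_RM: "?RL \<subseteq> ?RM" using LM by (auto simp: realization_def)
  have cs_RM: "closed_simplex (F i) \<subseteq> ?RM" if "i < N" for i
    using F[OF that] realization_eq_Union[OF M] by blast

  \<comment> \<open>A point \<open>x\<close> of a cell is a convex combination of the barycentre, with weight \<open>1 - \<rho> x\<close>, and a
     boundary point \<open>\<pi> x\<close>; the part \<open>\<mu> x\<close> of \<open>x\<close> comes from the barycentre. The smallest coordinate
     \<open>m i\<close> over \<open>F i\<close> is zero outside the interior of that cell, so at most one summand is nonzero,
     and on \<open>L\<close> we have \<open>\<mu> x = 0\<close>, \<open>\<rho> x = 1\<close> and \<open>\<pi> x = x\<close>.\<close>
  define m where "m i x = Min (x ` F i)" for i and x :: "'a \<Rightarrow> real"
  define \<mu> where "\<mu> x v = (\<Sum>i<N. m i x * of_bool (v \<in> F i))" for x v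
  define \<rho> where "\<rho> x = 1 - real (Suc d) * (\<Sum>i<N. m i x)" for x
  define \<pi> where "\<pi> x v = (x v - \<mu> x v) / \<rho> x" for x v
  have m_le: "m i x \<le> x v" if "i < N" "v \<in> F i" for i x v
    using that F by (simp add: m_def)
  have m_in: "\<exists>v\<in>F i. x v = m i x" if "i < N" for i x
  proof -
    have "m i x \<in> x ` F i"
      unfolding m_def using F[OF that] by (intro Min_in) auto
    then show ?thesis by force
  qed
  have nonneg: "0 \<le> x v" if "x \<in> ?RM" for x v
    using that by (simp add: realization_def)
  have m0: "0 \<le> m i x" if "i < N" "x \<in> ?RM" for i x
    using m_in[of i x] nonneg[OF that(2)] that(1) by auto (metis)
  have supp: "{v. x v \<noteq> 0} = F i" if "i < N" "x \<in> ?RM" "m i x > 0" for i x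
  proof -
    have sub: "F i \<subseteq> {v. x v \<noteq> 0}"
      using m_le[OF that(1), of _ x] that(3) by force
    have "{v. x v \<noteq> 0} \<in> M" using that(2) by (simp add: realization_def)
    moreover have "{v. x v \<noteq> 0} \<notin> L"
      using sub F(2)[OF that(1)] L by (auto simp: abstract_complex_def)
    ultimately have "{v. x v \<noteq> 0} \<in> F ` {..<N}"
      using cells by (auto simp: bij_betw_def)
    then obtain j where j: "j < N" "{v. x v \<noteq> 0} = F j" by auto
    then show ?thesis
      using card_subset_eq[OF F(3)[OF j(1)], of "F i"] sub cardF that(1) by auto
  qed
  have on_L: "m i x = 0" if "i < N" "x \<in> ?RL" for i x
  proof (rule ccontr)
    have x: "x \<in> ?RM" using that RL_RM by blast
    assume "m i x \<noteq> 0"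
    then have "m i x > 0" using m0[OF that(1) x] by simp
    then have "{v. x v \<noteq> 0} = F i" by (rule supp[OF that(1) x])
    then show False using F(2)[OF that(1)] that(2) by (simp add: realization_def)
  qed
  have \<mu>_L: "\<mu> x = (\<lambda>v. 0)" and \<rho>_L: "\<rho> x = 1" if "x \<in> ?RL" for x
    using on_L that by (simp_all add: \<mu>_def \<rho>_def fun_eq_iff)
  have cases_M: "x \<in> ?RL \<or> (\<exists>i<N. {v. x v \<noteq> 0} = F i)" if "x \<in> ?RM" for x
  proof (cases "{v. x v \<noteq> 0} \<in> L")
    case True
    then show ?thesis using that by (simp add: realization_def)
  next
    case False
    then have "{v. x v \<noteq> 0} \<in> M - L"
      using that by (simp add: realization_def)
    also have "\<dots> = F ` {..<N}"
      using cells by (simp add: bij_betw_def)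
    finally show ?thesis by auto
  qed
  have on_cell: "m i x > 0" "\<mu> x = (\<lambda>v. m i x * of_bool (v \<in> F i))" "\<rho> x = 1 - real (Suc d) * m i x"
    "sum x (F i) = 1" "\<And>v. v \<notin> F i \<Longrightarrow> x v = 0" "\<rho> x \<ge> 0" "\<rho> x < 1"
    if i: "i < N" and x: "x \<in> ?RM" and eq: "{v. x v \<noteq> 0} = F i" for i x
  proof -
    obtain w where "w \<in> F i" "x w = m i x" using m_in[OF i] by blast
    then have "m i x \<noteq> 0" using eq by force
    then show pos: "m i x > 0" using m0[OF i x] by simp
    have other: "m j x = 0" if "j < N" "j \<noteq> i" for j
    proof (rule ccontr)
      assume "m j x \<noteq> 0"
      then have "m j x > 0" using m0[OF that(1) x] by simp
      then have "F j = F i" using supp[OF that(1) x] eq by simp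
      then show False using F_inj[OF that(1) i] that(2) by simp
    qed
    have "(\<Sum>j<N. m j x * of_bool (v \<in> F j)) = (\<Sum>j<N. if j = i then m i x * of_bool (v \<in> F i) else 0)" for v
      by (rule sum.cong) (auto simp: other)
    then show "\<mu> x = (\<lambda>v. m i x * of_bool (v \<in> F i))"
      using i by (auto simp: \<mu>_def fun_eq_iff)
    have "(\<Sum>j<N. m j x) = (\<Sum>j<N. if j = i then m i x else 0)"
      by (rule sum.cong) (auto simp: other)
    then show \<rho>: "\<rho> x = 1 - real (Suc d) * m i x"
      using i by (simp add: \<rho>_def)
    show s: "sum x (F i) = 1"
      using x eq by (simp add: realization_def)
    show "\<And>v. v \<notin> F i \<Longrightarrow> x v = 0" using eq by blast
    have "(\<Sum>v\<in>F i. m i x) \<le> sum x (F i)"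
      by (rule sum_mono) (use m_le i in auto)
    then show "\<rho> x \<ge> 0" using s cardF[OF i] by (simp add: \<rho>)
    show "\<rho> x < 1" using pos by (simp add: \<rho>)
  qed
  have sum_\<mu>: "(\<Sum>v\<in>F i. \<mu> x v) = 1 - \<rho> x" if "i < N" "x \<in> ?RM" "{v. x v \<noteq> 0} = F i" for i x
    using on_cell(2,3)[OF that] cardF[OF that(1)] by simp
  have \<pi>_L: "\<pi> x \<in> ?RL" if x: "x \<in> ?RM" and pos: "\<rho> x > 0" for x
    using cases_M[OF x]
  proof
    assume L: "x \<in> ?RL"
    then have "\<pi> x = x" using \<mu>_L \<rho>_L by (simp add: \<pi>_def fun_eq_iff)
    with L show ?thesis by simp
  next
    assume "\<exists>i<N. {v. x v \<noteq> 0} = F i"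
    then obtain i where i: "i < N" "{v. x v \<noteq> 0} = F i" by blast
    note c = on_cell[OF i(1) x i(2)]
    obtain w where w: "w \<in> F i" "x w = m i x" using m_in[OF i(1)] by blast
    have zero: "\<pi> x v = 0" if "v \<notin> F i - {w}" for v
      using that w c(2,5) by (cases "v = w") (auto simp: \<pi>_def)
    have "sum (\<pi> x) (F i) = (sum x (F i) - sum (\<mu> x) (F i)) / \<rho> x"
      by (simp add: \<pi>_def sum_subtractf sum_divide_distrib[symmetric])
    also have "\<dots> = 1" using c(4) sum_\<mu>[OF i(1) x i(2)] pos by simp
    finally have "sum (\<pi> x) (F i - {w}) = 1"
      using zero F[OF i(1)] w by (simp add: sum_diff1)
    moreover have "0 \<le> \<pi> x v" for v
      using c(2,5) m_le[OF i(1), of v x] pos by (cases "v \<in> F i") (auto simp: \<pi>_def)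
    moreover have "F i - {w} \<in> L"
      using proper[OF i(1)] w(1) by blast
    ultimately show ?thesis
      using realizationI[OF L] zero by blast
  qed

  obtain a and H :: "real \<times> ('a \<Rightarrow> real) \<Rightarrow> 'a \<Rightarrow> real"
    where H: "continuous_map (prod_topology (top_of_set {0..1}) (top_of_set ?RL)) (top_of_set ?RL) H"
    and H0: "\<And>x. H (0, x) = x" and H1: "\<And>x. H (1, x) = a"
    using contr by (auto simp: contractible_space_def homotopic_with_def geometric_realization_eq)
  have H: "continuous_on ({0..1} \<times> ?RL) H" "H ` ({0..1} \<times> ?RL) \<subseteq> ?RL"
    using H by (auto simp: prod_topology_subtopology_eu)

  \<comment> \<open>At time \<open>s\<close> the barycentre part of \<open>x\<close> is scaled by \<open>1 - 2 * s * \<rho> x\<close>, as long as this is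
     nonnegative, and the boundary part is scaled so that the total mass remains one. When the factor
     reaches zero, the point is at \<open>\<pi> x\<close>. The factor depends on \<open>\<rho> x\<close> so that no division is needed
     near the barycentre.\<close>
  define inner where "inner = (\<lambda>(s, x) v.
      (1 + 2 * s * (1 - \<rho> x)) * (x v - \<mu> x v) + (1 - 2 * s * \<rho> x) * \<mu> x v)"
  define outer where "outer = (\<lambda>(s, x). H (2 * s * \<rho> x - 1, \<pi> x))"
  define h where "h z = (if 2 * fst z * \<rho> (snd z) \<le> 1 then inner z else outer z)" for z
  have inner_in: "inner (s, x) \<in> ?RM" if x: "x \<in> ?RM" and s: "s \<in> {0..1}" "2 * s * \<rho> x \<le> 1" for s x
    using cases_M[OF x]
  proof
    assume "x \<in> ?RL"
    then show ?thesis using \<mu>_L \<rho>_L x by (simp add: inner_def)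
  next
    assume "\<exists>i<N. {v. x v \<noteq> 0} = F i"
    then obtain i where i: "i < N" "{v. x v \<noteq> 0} = F i" by blast
    note c = on_cell[OF i(1) x i(2)]
    show ?thesis
    proof (rule realizationI[OF M _ F(1)[OF i(1)]])
      show "inner (s, x) v = 0" if "v \<notin> F i" for v
        using that c(2,5) by (simp add: inner_def)
      show "0 \<le> inner (s, x) v" for v
      proof (cases "v \<in> F i")
        case True
        have "0 \<le> 2 * s * (1 - \<rho> x)"
          using s c(7) by (intro mult_nonneg_nonneg) auto
        moreover have "0 \<le> x v - \<mu> x v" "0 \<le> \<mu> x v"
          using c(1,2) m_le[OF i(1) True, of x] True by auto
        ultimately have "0 \<le> (1 + 2 * s * (1 - \<rho> x)) * (x v - \<mu> x v)"
          "0 \<le> (1 - 2 * s * \<rho> x) * \<mu> x v"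
          using s by (auto intro!: mult_nonneg_nonneg[OF _ \<open>0 \<le> x v - \<mu> x v\<close>]
              mult_nonneg_nonneg[OF _ \<open>0 \<le> \<mu> x v\<close>])
        then show ?thesis
          unfolding inner_def split by (rule add_nonneg_nonneg)
      qed (use c(2,5) in \<open>simp add: inner_def\<close>)
      have "sum (inner (s, x)) (F i)
          = (1 + 2 * s * (1 - \<rho> x)) * (sum x (F i) - sum (\<mu> x) (F i)) + (1 - 2 * s * \<rho> x) * sum (\<mu> x) (F i)"
        by (simp only: inner_def split sum.distrib sum_subtractf sum_distrib_left[symmetric])
      also have "\<dots> = 1"
        unfolding c(4) sum_\<mu>[OF i(1) x i(2)] by (simp add: algebra_simps)
      finally show "sum (inner (s, x)) (F i) = 1" .
    qed
  qed
  have \<rho>_le1: "\<rho> x \<le> 1" if "x \<in> ?RM" for x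
    using cases_M[OF that]
  proof
    assume "x \<in> ?RL"
    then show ?thesis using \<rho>_L by simp
  next
    assume "\<exists>i<N. {v. x v \<noteq> 0} = F i"
    then show ?thesis using on_cell(7)[OF _ that] less_imp_le by blast
  qed
  have \<rho>_pos: "\<rho> x > 0" if "0 \<le> s" "1 \<le> 2 * s * \<rho> x" for s x
  proof (rule ccontr)
    assume "\<not> \<rho> x > 0"
    then have "s * \<rho> x \<le> 0" using that(1) by (intro mult_nonneg_nonpos) auto
    then show False using that(2) by simp
  qed
  have outer_in: "outer (s, x) \<in> ?RL" if x: "x \<in> ?RM" and s: "s \<in> {0..1}" "1 \<le> 2 * s * \<rho> x" for s x
  proof -
    have pos: "\<rho> x > 0" using s by (intro \<rho>_pos[of s x]) auto
    have "s * \<rho> x \<le> 1" using s \<rho>_le1[OF x] pos by (simp add: mult_le_one)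
    then have "(2 * s * \<rho> x - 1, \<pi> x) \<in> {0..1} \<times> ?RL"
      using s \<pi>_L[OF x pos] by simp
    then show ?thesis
      unfolding outer_def split by (rule subsetD[OF H(2) imageI])
  qed

  have cont_m: "continuous_on S (m i)" if "i < N" for S i
    unfolding m_def using F[OF that]
    by (intro continuous_on_Min_image continuous_on_product_then_coordinatewise[OF continuous_on_id])
  have cont_\<rho>: "continuous_on S \<rho>" for S
    unfolding \<rho>_def by (intro continuous_on_diff continuous_on_mult continuous_on_sum continuous_on_const cont_m) auto
  have cont_\<mu>: "continuous_on S (\<lambda>x. \<mu> x v)" for S v
    unfolding \<mu>_def by (intro continuous_on_mult continuous_on_sum continuous_on_const cont_m) auto
  have cont_x: "continuous_on S (\<lambda>x. x v)" for S :: "('a \<Rightarrow> real) set" and v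
    by (intro continuous_on_product_then_coordinatewise[OF continuous_on_id])
  have snd: "continuous_on S g \<Longrightarrow> continuous_on T (\<lambda>z. g (snd z))" if "snd ` T \<subseteq> S"
    for T :: "(real \<times> ('a \<Rightarrow> real)) set" and S and g :: "('a \<Rightarrow> real) \<Rightarrow> real"
    using continuous_on_compose2[of S g T snd] continuous_on_snd[OF continuous_on_id] that by blast
  have cont_inner: "continuous_on S inner" for S
    unfolding inner_def case_prod_unfold
    by (intro continuous_on_coordinatewise_then_product continuous_on_add continuous_on_mult
       continuous_on_diff continuous_on_const continuous_on_fst continuous_on_id
       snd[OF subset_UNIV cont_\<rho>] snd[OF subset_UNIV cont_\<mu>] snd[OF subset_UNIV cont_x])
  have cont_outer: "continuous_on {z \<in> {0..1} \<times> ?RM. 1 \<le> 2 * fst z * \<rho> (snd z)} outer" (is "continuous_on ?O _")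
  proof -
    have pos: "\<rho> (snd z) > 0" if "z \<in> ?O" for z
      using that by (intro \<rho>_pos[of "fst z"]) auto
    have "continuous_on ?O (\<lambda>z. (2 * fst z * \<rho> (snd z) - 1, \<pi> (snd z)))"
      unfolding \<pi>_def
      by (intro continuous_on_Pair continuous_on_coordinatewise_then_product continuous_on_mult
         continuous_on_diff continuous_on_divide continuous_on_const continuous_on_fst continuous_on_id
         snd[OF subset_UNIV cont_\<rho>] snd[OF subset_UNIV cont_\<mu>] snd[OF subset_UNIV cont_x])
       (use pos in force)
    moreover have "(\<lambda>z. (2 * fst z * \<rho> (snd z) - 1, \<pi> (snd z))) ` ?O \<subseteq> {0..1} \<times> ?RL"
    proof clarsimp
      fix s x assume z: "x \<in> ?RM" "0 \<le> s" "s \<le> 1" "1 \<le> 2 * s * \<rho> x"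
      then have "\<rho> x > 0" using pos[of "(s, x)"] by simp
      then show "s * \<rho> x \<le> 1 \<and> \<pi> x \<in> ?RL"
        using \<pi>_L z \<rho>_le1 by (simp add: mult_le_one)
    qed
    ultimately show ?thesis
      unfolding outer_def case_prod_unfold by (rule continuous_on_compose2[OF H(1)])
  qed
  have h_cont: "continuous_map (prod_topology (top_of_set {0..1}) (top_of_set ?RM)) (top_of_set ?RM) h"
  proof -
    let ?X = "top_of_set ({0..1} \<times> ?RM)"
    have p: "continuous_map ?X euclideanreal (\<lambda>z. 2 * fst z * \<rho> (snd z))"
      unfolding continuous_map_iff_continuous
      by (intro continuous_on_mult continuous_on_const continuous_on_fst continuous_on_id
          snd[OF subset_UNIV cont_\<rho>])
    have "continuous_map ?X (top_of_set ?RM) (\<lambda>z. if 2 * fst z * \<rho> (snd z) \<le> 1 then inner z else outer z)"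
    proof (rule continuous_map_cases_le[OF p continuous_map_const[THEN iffD2]])
      show "continuous_map (subtopology ?X {z \<in> topspace ?X. 2 * fst z * \<rho> (snd z) \<le> 1}) (top_of_set ?RM) inner"
        using cont_inner inner_in by (auto simp: subtopology_subtopology)
      have "({0..1} \<times> ?RM) \<inter> {z \<in> {0..1} \<times> ?RM. 1 \<le> 2 * fst z * \<rho> (snd z)}
          = {z \<in> {0..1} \<times> ?RM. 1 \<le> 2 * fst z * \<rho> (snd z)}" by blast
      then show "continuous_map (subtopology ?X {z \<in> topspace ?X. 1 \<le> 2 * fst z * \<rho> (snd z)}) (top_of_set ?RM) outer"
        using cont_outer outer_in RL_RM by (fastforce simp: subtopology_subtopology)
      show "inner z = outer z" if "z \<in> topspace ?X" and eq: "2 * fst z * \<rho> (snd z) = 1" for z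
      proof -
        obtain s x where z: "z = (s, x)" by (cases z)
        have "\<rho> x \<noteq> 0" using eq z by auto
        have "1 + 2 * s * (1 - \<rho> x) = 2 * s" using eq z by (simp add: algebra_simps)
        also have "\<dots> = 1 / \<rho> x" using eq z \<open>\<rho> x \<noteq> 0\<close> by (simp add: field_simps)
        finally have "inner z = \<pi> x"
          using eq z by (auto simp: inner_def \<pi>_def fun_eq_iff)
        then show ?thesis using eq z by (simp add: outer_def H0)
      qed
    qed simp
    then show ?thesis
      by (simp add: h_def[abs_def] prod_topology_subtopology_eu)
  qed

  define chart where "chart i \<phi> \<longleftrightarrow>
      continuous_on (closed_simplex (F i)) \<phi> \<and> \<phi> ` closed_simplex (F i) \<subseteq> topspace (nsphere d) \<and>
      (\<forall>x\<in>closed_simplex (F i). \<phi> x = ?b \<longleftrightarrow> (\<exists>v\<in>F i. x v = 0)) \<and>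
      inj_on \<phi> {x \<in> closed_simplex (F i). \<forall>v\<in>F i. x v \<noteq> 0} \<and>
      topspace (nsphere d) - {?b} \<subseteq> \<phi> ` closed_simplex (F i)" for i \<phi>
  have "\<exists>\<phi>. chart i \<phi>" if "i < N" for i
    unfolding chart_def by (rule closed_simplex_onto_sphere[OF F(3)[OF that] cardF[OF that]]) blast
  then obtain \<phi> where chart: "\<And>i. i < N \<Longrightarrow> chart i (\<phi> i)"
    by metis
  have \<phi>_cont: "continuous_on (closed_simplex (F i)) (\<phi> i)"
    and \<phi>_in: "\<phi> i ` closed_simplex (F i) \<subseteq> topspace (nsphere d)"
    and \<phi>_base: "\<And>x. x \<in> closed_simplex (F i) \<Longrightarrow> \<phi> i x = ?b \<longleftrightarrow> (\<exists>v\<in>F i. x v = 0)"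
    and \<phi>_inj: "inj_on (\<phi> i) {x \<in> closed_simplex (F i). \<forall>v\<in>F i. x v \<noteq> 0}"
    and \<phi>_onto: "topspace (nsphere d) - {?b} \<subseteq> \<phi> i ` closed_simplex (F i)" if "i < N" for i
    using chart[OF that] by (simp_all add: chart_def)
  \<comment> \<open>Away from \<open>L\<close>, the cell containing \<open>x\<close> in its interior is unique.\<close>
  define f where "f x = (if x \<in> ?RL then None else
      let i = (THE i. i < N \<and> {v. x v \<noteq> 0} = F i) in Some (i, \<phi> i x))" for x
  have f_L: "f x = None" if "x \<in> ?RL" for x using that by (simp add: f_def)
  have f_open: "f x = Some (i, \<phi> i x)" "x \<in> closed_simplex (F i)" "\<forall>v\<in>F i. x v \<noteq> 0" "\<phi> i x \<noteq> ?b"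
    if "i < N" "x \<in> ?RM" "{v. x v \<noteq> 0} = F i" for i x
  proof -
    have "x \<notin> ?RL" using that F by (auto simp: realization_def)
    moreover have "(THE i. i < N \<and> {v. x v \<noteq> 0} = F i) = i"
      using that F_inj by (intro the_equality) auto
    ultimately show "f x = Some (i, \<phi> i x)" by (simp add: f_def)
    show c: "x \<in> closed_simplex (F i)"
      using that on_cell(4,5)[OF that] nonneg[OF that(2)] by (simp add: closed_simplex_def)
    show v: "\<forall>v\<in>F i. x v \<noteq> 0" using that(3) by blast
    then show "\<phi> i x \<noteq> ?b" using \<phi>_base[OF that(1) c] by simp
  qed
  have f_cell: "f x = ?p (i, \<phi> i x)" if i: "i < N" and x: "x \<in> closed_simplex (F i)" for i x
  proof (cases "{v. x v \<noteq> 0} = F i")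
    case True
    then show ?thesis using f_open[OF i _ True] cs_RM[OF i] x by (auto simp: wedge_proj_def)
  next
    case False
    have "{v. x v \<noteq> 0} \<subseteq> F i" using x by (auto simp: closed_simplex_def)
    with False have "{v. x v \<noteq> 0} \<in> L" "\<exists>v\<in>F i. x v = 0" using proper[OF i] by blast+
    then show ?thesis
      using f_L[of x] \<phi>_base[OF i x] cs_RM[OF i] x by (auto simp: realization_def wedge_proj_def)
  qed
  have f_eq: "x = y \<or> x \<in> ?RL \<and> y \<in> ?RL" if x: "x \<in> ?RM" and y: "y \<in> ?RM" and eq: "f x = f y" for x y
  proof (cases "x \<in> ?RL \<or> y \<in> ?RL")
    case True
    then have "f x = None" "f y = None" using eq f_L by auto
    then show ?thesis using cases_M[OF x] cases_M[OF y] f_open(1)[OF _ x] f_open(1)[OF _ y] by auto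
  next
    case False
    then obtain i j where i: "i < N" "{v. x v \<noteq> 0} = F i" and j: "j < N" "{v. y v \<noteq> 0} = F j"
      using cases_M[OF x] cases_M[OF y] by blast
    note fx = f_open[OF i(1) x i(2)] and fy = f_open[OF j(1) y j(2)]
    have "i = j" "\<phi> i x = \<phi> i y" using fx(1) fy(1) eq by auto
    then show ?thesis
      using \<phi>_inj[OF i(1)] fx(2,3) fy(2,3) by (auto simp: inj_on_def)
  qed
  have h_L: "h (s, x) \<in> ?RL" if "s \<in> {0..1}" "x \<in> ?RL" for s x
    using that outer_in[of x s] RL_RM \<mu>_L[of x] \<rho>_L[of x]
    by (cases "2 * s \<le> 1") (auto simp: h_def inner_def)

  have topW: "topspace (wedge_of_spheres N d) = insert None (?p ` ({..<N} \<times> topspace (nsphere d)))"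
    by (simp add: wedge_of_spheres_def topspace_wedge)
  have RM_cover: "?RM = ?RL \<union> (\<Union>i<N. closed_simplex (F i))"
  proof (intro subset_antisym subsetI)
    fix x assume x: "x \<in> ?RM"
    show "x \<in> ?RL \<union> (\<Union>i<N. closed_simplex (F i))"
      using cases_M[OF x] f_open(2)[OF _ x] by auto
  qed (use RL_RM cs_RM in blast)
  have quot: "quotient_map (top_of_set ?RM) (wedge_of_spheres N d) f"
    unfolding quotient_map_closedin
  proof (intro conjI allI impI)
    show "f ` topspace (top_of_set ?RM) = topspace (wedge_of_spheres N d)"
    proof
      show "f ` topspace (top_of_set ?RM) \<subseteq> topspace (wedge_of_spheres N d)"
        using f_L f_cell \<phi>_in unfolding RM_cover topW by (fastforce simp: image_iff)
      have "None \<in> f ` ?RM" using ne f_L RL_RM by (force simp: image_iff)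
      moreover have "?p (i, y) \<in> f ` ?RM" if i: "i < N" and y: "y \<in> topspace (nsphere d)" for i y
      proof (cases "y = ?b")
        case True
        then show ?thesis using \<open>None \<in> f ` ?RM\<close> by (simp add: wedge_proj_def)
      next
        case False
        then obtain x where "x \<in> closed_simplex (F i)" "y = \<phi> i x"
          using \<phi>_onto[OF i] y by blast
        then show ?thesis using f_cell[OF i] cs_RM[OF i] by force
      qed
      ultimately show "topspace (wedge_of_spheres N d) \<subseteq> f ` topspace (top_of_set ?RM)"
        unfolding topW by auto
    qed
    fix C assume C: "C \<subseteq> topspace (wedge_of_spheres N d)"
    let ?A = "{x \<in> ?RM. f x \<in> C}"
    let ?C = "\<lambda>i. {y \<in> topspace (nsphere d). ?p (i, y) \<in> C}"
    have top_sphere: "nsphere d = top_of_set (topspace (nsphere d))"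
      by (simp add: nsphere euclidean_product_topology)
    have "closedin (top_of_set ?RM) ?A \<longleftrightarrow> (\<forall>i<N. closedin (nsphere d) (?C i))"
    proof (intro iffI allI impI)
      fix i assume A: "closedin (top_of_set ?RM) ?A" and i: "i < N"
      have "closed ?A"
        using A closed_realization[OF M] closedin_closed_trans by blast
      then have "compact (closed_simplex (F i) \<inter> ?A)"
        using compact_closed_simplex F(3)[OF i] by blast
      then have "compact (\<phi> i ` (closed_simplex (F i) \<inter> ?A))"
        by (intro compact_continuous_image continuous_on_subset[OF \<phi>_cont[OF i]]) auto
      \<comment> \<open>The base point is treated apart because \<open>\<phi> i\<close> misses it if the cell is a vertex.\<close>
      then have "closed (\<phi> i ` (closed_simplex (F i) \<inter> ?A) \<union> (if None \<in> C then {?b} else {}))"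
        by (intro closed_Un compact_imp_closed) auto
      moreover have "?C i = \<phi> i ` (closed_simplex (F i) \<inter> ?A) \<union> (if None \<in> C then {?b} else {})"
      proof (intro subset_antisym subsetI)
        fix y assume y: "y \<in> ?C i"
        show "y \<in> \<phi> i ` (closed_simplex (F i) \<inter> ?A) \<union> (if None \<in> C then {?b} else {})"
        proof (cases "y = ?b")
          case True
          then show ?thesis using y by (simp add: wedge_proj_def)
        next
          case False
          then obtain x where "x \<in> closed_simplex (F i)" "y = \<phi> i x"
            using \<phi>_onto[OF i] y by blast
          then show ?thesis using f_cell[OF i] cs_RM[OF i] y by force
        qed
      next
        fix y assume "y \<in> \<phi> i ` (closed_simplex (F i) \<inter> ?A) \<union> (if None \<in> C then {?b} else {})"
        then show "y \<in> ?C i"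
          using f_cell[OF i] \<phi>_in[OF i] sphere_basepoint_in_nsphere[of d]
          by (auto simp: wedge_proj_def split: if_splits)
      qed
      ultimately have "closed (?C i)" by simp
      then show "closedin (nsphere d) (?C i)"
        by (subst top_sphere) (auto intro: closed_subset)
    next
      assume cl: "\<forall>i<N. closedin (nsphere d) (?C i)"
      have eq: "?A = (if None \<in> C then ?RL else {}) \<union> (\<Union>i<N. {x \<in> closed_simplex (F i). \<phi> i x \<in> ?C i})"
      proof (intro subset_antisym subsetI)
        fix x assume "x \<in> ?A"
        then show "x \<in> (if None \<in> C then ?RL else {}) \<union> (\<Union>i<N. {x \<in> closed_simplex (F i). \<phi> i x \<in> ?C i})"
          using RM_cover f_L f_cell \<phi>_in by fastforce
      next
        fix x assume "x \<in> (if None \<in> C then ?RL else {}) \<union> (\<Union>i<N. {x \<in> closed_simplex (F i). \<phi> i x \<in> ?C i})"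
        then show "x \<in> ?A"
          using subsetD[OF RL_RM] subsetD[OF cs_RM] by (auto simp: f_L f_cell split: if_splits)
      qed
      have "closed {x \<in> closed_simplex (F i). \<phi> i x \<in> ?C i}" if i: "i < N" for i
      proof -
        have "\<exists>T. closed T \<and> D = topspace (nsphere d) \<inter> T" if "closedin (nsphere d) D" for D
          using that by (auto simp: nsphere euclidean_product_topology closedin_closed)
        moreover have "closedin (nsphere d) (?C i)"
          using cl i by blast
        ultimately obtain T where T: "closed T" "?C i = topspace (nsphere d) \<inter> T"
          by meson
        then have "{x \<in> closed_simplex (F i). \<phi> i x \<in> ?C i} = closed_simplex (F i) \<inter> \<phi> i -` T"
          using \<phi>_in[OF i] by blast
        then show ?thesis
          using continuous_closed_preimage[OF \<phi>_cont[OF i] closed_closed_simplex T(1)] by simp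
      qed
      then have "closed ?A"
        unfolding eq using closed_realization[OF L] by (intro closed_Un closed_UN) auto
      then show "closedin (top_of_set ?RM) ?A"
        by (intro closed_subset) auto
    qed
    then show "closedin (top_of_set ?RM) {x \<in> topspace (top_of_set ?RM). f x \<in> C}
        \<longleftrightarrow> closedin (wedge_of_spheres N d) C"
      using C by (simp add: closedin_wedge_of_spheres)
  qed

  show ?thesis
    unfolding geometric_realization_eq
  proof (rule homotopy_equivalent_space_quotient[OF quot h_cont])
    show "h (0, x) = x" for x
      by (simp add: h_def inner_def)
    show "f (h (s, x)) = f (h (s, y))"
      if "s \<in> {0..1}" "x \<in> topspace (top_of_set ?RM)" "y \<in> topspace (top_of_set ?RM)" "f x = f y" for s x y
      using f_eq[of x y] that h_L f_L by auto
    have "h (1, x) = a" if "x \<in> ?RL" for x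
      using \<rho>_L[OF that] by (simp add: h_def outer_def H1)
    then show "h (1, x) = h (1, y)"
      if "x \<in> topspace (top_of_set ?RM)" "y \<in> topspace (top_of_set ?RM)" "f x = f y" for x y
      using f_eq[of x y] that by auto
  qed
qed


section \<open>Acyclic matchings\<close>

text \<open>
  Each face \<open>\<sigma> \<in> A\<close> is matched with \<open>insert (e \<sigma>) \<sigma>\<close>. Acyclicity is expressed by a rank that decreases
  along the paths of the matching: from \<open>\<sigma>\<close> up to its partner, and down to another facet of the
  partner that lies in \<open>A\<close>.
\<close>

definition acyclic_matching :: "'a set set \<Rightarrow> 'a set set \<Rightarrow> ('a set \<Rightarrow> 'a) \<Rightarrow> ('a set \<Rightarrow> nat) \<Rightarrow> bool" where
  "acyclic_matching K A e r \<longleftrightarrow>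
     A \<subseteq> K \<and> (\<forall>\<sigma>\<in>A. e \<sigma> \<notin> \<sigma> \<and> insert (e \<sigma>) \<sigma> \<in> K - A) \<and>
     inj_on (\<lambda>\<sigma>. insert (e \<sigma>) \<sigma>) A \<and>
     (\<forall>\<sigma>\<in>A. \<forall>x\<in>\<sigma>. insert (e \<sigma>) \<sigma> - {x} \<in> A \<longrightarrow> r (insert (e \<sigma>) \<sigma> - {x}) < r \<sigma>)"

definition critical :: "'a set set \<Rightarrow> 'a set set \<Rightarrow> ('a set \<Rightarrow> 'a) \<Rightarrow> 'a set set" where
  "critical K A e = K - A - (\<lambda>\<sigma>. insert (e \<sigma>) \<sigma>) ` A"

text \<open>
  Among the matched pairs whose lower face has at least \<open>c\<close> vertices, take one whose lower face \<open>\<sigma>\<close> has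
  the largest size, and among these the largest rank. Then \<open>\<sigma>\<close> is a free face: another face
  \<open>insert x \<sigma>\<close> is too large to be critical or to belong to \<open>A\<close>, and if it were the partner of some
  \<open>\<sigma>2\<close>, then \<open>\<sigma>2\<close> would have a larger rank than \<open>\<sigma>\<close>. So the pair can be collapsed.
\<close>

lemma collapse_above_critical:
  assumes "abstract_complex K" "acyclic_matching K A e r"
    and "\<And>\<sigma>. \<sigma> \<in> critical K A e \<Longrightarrow> card \<sigma> \<le> c" and c: "1 \<le> c"
  shows "\<exists>K'\<subseteq>K. abstract_complex K' \<and> acyclic_matching K' {\<sigma>\<in>A. card \<sigma> < c} e r \<and>
           critical K' {\<sigma>\<in>A. card \<sigma> < c} e = critical K A e \<and>
           geometric_realization K homotopy_equivalent_space geometric_realization K'"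
  using assms(1-3)
proof (induction "card {\<sigma>\<in>A. c \<le> card \<sigma>}" arbitrary: K A rule: less_induct)
  case less
  note K = less.prems(1) and mat = less.prems(2) and crit = less.prems(3)
  define up where "up \<sigma> = insert (e \<sigma>) \<sigma>" for \<sigma>
  have A: "A \<subseteq> K" and e: "\<And>\<sigma>. \<sigma> \<in> A \<Longrightarrow> e \<sigma> \<notin> \<sigma>" and upK: "\<And>\<sigma>. \<sigma> \<in> A \<Longrightarrow> up \<sigma> \<in> K - A"
    and inj: "inj_on up A"
    and rank: "\<And>\<sigma> x. \<sigma> \<in> A \<Longrightarrow> x \<in> \<sigma> \<Longrightarrow> up \<sigma> - {x} \<in> A \<Longrightarrow> r (up \<sigma> - {x}) < r \<sigma>"
    using mat[unfolded acyclic_matching_def, folded up_def] by (blast, blast, blast, simp, blast)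
  have finK: "finite K" and finf: "\<And>\<sigma>. \<sigma> \<in> K \<Longrightarrow> finite \<sigma>"
    and down: "\<And>\<sigma> \<tau>. \<sigma> \<in> K \<Longrightarrow> \<tau> \<subseteq> \<sigma> \<Longrightarrow> \<tau> \<in> K"
    using K by (auto simp: abstract_complex_def)
  let ?B = "{\<sigma>\<in>A. c \<le> card \<sigma>}"
  have finB: "finite ?B" using finK A by (auto intro: finite_subset)
  show ?case
  proof (cases "?B = {}")
    case True
    then have "{\<sigma>\<in>A. card \<sigma> < c} = A" by auto
    then show ?thesis using K mat homotopy_equivalent_space_refl by auto
  next
    case False
    define n where "n = Max (card ` ?B)"
    let ?B' = "{\<sigma>\<in>?B. card \<sigma> = n}"
    have "n \<in> card ` ?B" unfolding n_def using finB False by (intro Max_in) auto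
    then have "?B' \<noteq> {}" by blast
    moreover have finB': "finite ?B'" by (rule finite_subset[OF _ finB]) blast
    ultimately have "Max (r ` ?B') \<in> r ` ?B'" by (intro Max_in) simp_all
    then obtain \<sigma> where \<sigma>: "\<sigma> \<in> ?B'" "r \<sigma> = Max (r ` ?B')" by (metis (no_types, lifting) imageE)
    have max_card: "card \<tau> \<le> n" if "\<tau> \<in> ?B" for \<tau>
      unfolding n_def using finB that by (intro Max_ge finite_imageI imageI)
    have max_r: "r \<tau> \<le> r \<sigma>" if "\<tau> \<in> ?B'" for \<tau>
      unfolding \<sigma>(2) using finB' that by (intro Max_ge finite_imageI imageI)
    have \<sigma>A: "\<sigma> \<in> A" and c\<sigma>: "c \<le> card \<sigma>" "card \<sigma> = n" using \<sigma>(1) by auto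
    have fin\<sigma>: "finite \<sigma>" using \<sigma>A A finf by blast
    have \<sigma>ne: "\<sigma> \<noteq> {}" using c\<sigma>(1) c by auto
    have free: "\<rho> = \<sigma> \<or> \<rho> = up \<sigma>" if \<rho>: "\<rho> \<in> K" "\<sigma> \<subseteq> \<rho>" for \<rho>
    proof (rule ccontr)
      assume "\<not> ?thesis"
      then obtain x where x: "x \<in> \<rho>" "x \<notin> \<sigma>" "x \<noteq> e \<sigma>"
        using \<rho>(2) unfolding up_def by blast
      define \<eta> where "\<eta> = insert x \<sigma>"
      have \<eta>: "\<eta> \<in> K" "card \<eta> = Suc n" "\<eta> \<noteq> up \<sigma>"
        using down[OF \<rho>(1), of \<eta>] x \<rho>(2) fin\<sigma> c\<sigma> by (auto simp: \<eta>_def up_def)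
      then have "\<eta> \<notin> critical K A e" using crit c\<sigma> by fastforce
      moreover have "\<eta> \<notin> A" using max_card[of \<eta>] \<eta>(2) c\<sigma> by auto
      ultimately obtain \<sigma>2 where \<sigma>2: "\<sigma>2 \<in> A" "\<eta> = up \<sigma>2"
        using \<eta>(1) by (auto simp: critical_def up_def)
      have "card \<sigma>2 = n"
        using \<eta>(2) \<sigma>2 e[OF \<sigma>2(1)] finf A by (auto simp: up_def)
      then have "r \<sigma>2 \<le> r \<sigma>" using max_r \<sigma>2(1) c\<sigma> by auto
      moreover have "x \<in> \<sigma>2"
      proof (rule ccontr)
        assume "x \<notin> \<sigma>2"
        have up2: "insert x \<sigma> = insert (e \<sigma>2) \<sigma>2"
          using \<sigma>2(2) by (simp add: \<eta>_def up_def)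
        with \<open>x \<notin> \<sigma>2\<close> have "x = e \<sigma>2" by blast
        with up2 x(2) e[OF \<sigma>2(1)] have "\<sigma>2 = \<sigma>" by (metis insert_ident)
        then show False using \<sigma>2(2) \<eta>(3) by blast
      qed
      moreover have "up \<sigma>2 - {x} = \<sigma>" using \<sigma>2(2) x(2) by (auto simp: \<eta>_def)
      ultimately show False using rank[OF \<sigma>2(1), of x] \<sigma>A by simp
    qed
    define K1 where "K1 = K - {\<sigma>, up \<sigma>}"
    define A1 where "A1 = A - {\<sigma>}"
    have K1: "abstract_complex K1"
      unfolding K1_def up_def by (rule abstract_complex_collapse[OF K]) (use free up_def in auto)
    have equiv: "geometric_realization K homotopy_equivalent_space geometric_realization K1"
      unfolding K1_def up_def
      by (rule elementary_collapse[OF K \<sigma>ne e[OF \<sigma>A]]) (use free upK[OF \<sigma>A] up_def in auto)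
    have up_other: "up \<tau> \<noteq> up \<sigma>" "up \<tau> \<noteq> \<sigma>" if "\<tau> \<in> A1" for \<tau>
      using that inj upK[of \<tau>] \<sigma>A by (auto simp: A1_def inj_on_def)
    have mat1: "acyclic_matching K1 A1 e r"
      unfolding acyclic_matching_def up_def[symmetric] using up_other A e upK inj rank \<sigma>A
      by (auto simp: A1_def K1_def inj_on_def)
    have crit1: "critical K1 A1 e = critical K A e"
      unfolding critical_def up_def[symmetric] using up_other \<sigma>A upK by (auto simp: A1_def K1_def)
    have "{\<tau>\<in>A1. c \<le> card \<tau>} \<subset> ?B" using \<sigma> by (auto simp: A1_def)
    then have "card {\<tau>\<in>A1. c \<le> card \<tau>} < card ?B" using finB by (rule psubset_card_mono[rotated])
    then obtain K' where K': "K' \<subseteq> K1" "abstract_complex K'" "acyclic_matching K' {\<sigma>\<in>A1. card \<sigma> < c} e r"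
      "critical K' {\<sigma>\<in>A1. card \<sigma> < c} e = critical K1 A1 e"
      "geometric_realization K1 homotopy_equivalent_space geometric_realization K'"
      using less.hyps[of A1 K1] K1 mat1 crit crit1 by auto
    have A1c: "{\<sigma>\<in>A1. card \<sigma> < c} = {\<sigma>\<in>A. card \<sigma> < c}"
      using c\<sigma>(1) by (auto simp: A1_def)
    have "K' \<subseteq> K" using K'(1) by (auto simp: K1_def)
    then show ?thesis
      using K'(2-4) homotopy_eqv_trans[OF equiv K'(5)] unfolding A1c crit1 by blast
  qed
qed

lemma realization_vertex: "realization {{}, {v}} = {\<lambda>u. of_bool (u = v)}"
proof -
  have cx: "abstract_complex {{}, {v}}" by (auto simp: abstract_complex_def)
  show ?thesis
    by (subst realization_eq_Union[OF cx]) (force simp: closed_simplex_def fun_eq_iff)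
qed

text \<open>
  Collapsing with threshold \<open>Suc d\<close> leaves a complex of dimension at most \<open>d\<close>, where the critical faces
  are maximal. Removing them gives a complex that collapses further, with threshold \<open>1\<close>, to the pair
  formed by the empty face and a vertex.
\<close>

theorem acyclic_matching_imp_wedge_of_spheres:
  assumes K: "abstract_complex K" and ne: "{} \<in> K" and mat: "acyclic_matching K A e r"
    and crit: "\<And>\<sigma>. \<sigma> \<in> critical K A e \<Longrightarrow> card \<sigma> = Suc d"
  shows "geometric_realization K homotopy_equivalent_space
         wedge_of_spheres (card (critical K A e)) d"
proof -
  let ?C = "critical K A e"
  let ?A = "{\<sigma>\<in>A. card \<sigma> < Suc d}"
  obtain M where M: "M \<subseteq> K" "abstract_complex M" "acyclic_matching M ?A e r" "critical M ?A e = ?C"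
    and KM: "geometric_realization K homotopy_equivalent_space geometric_realization M"
    using collapse_above_critical[OF K mat, of "Suc d"] crit by auto
  have finM: "finite M" "\<And>\<sigma>. \<sigma> \<in> M \<Longrightarrow> finite \<sigma>" "\<And>\<sigma> \<tau>. \<sigma> \<in> M \<Longrightarrow> \<tau> \<subseteq> \<sigma> \<Longrightarrow> \<tau> \<in> M"
    using M(2) by (auto simp: abstract_complex_def)
  have card_M: "card \<sigma> \<le> Suc d" if \<sigma>M: "\<sigma> \<in> M" for \<sigma>
  proof -
    consider "\<sigma> \<in> ?C" | "\<sigma> \<in> ?A" | \<tau> where "\<tau> \<in> ?A" "\<sigma> = insert (e \<tau>) \<tau>"
    proof -
      assume *: "\<sigma> \<in> ?C \<Longrightarrow> thesis" "\<sigma> \<in> ?A \<Longrightarrow> thesis"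
        "\<And>\<tau>. \<tau> \<in> ?A \<Longrightarrow> \<sigma> = insert (e \<tau>) \<tau> \<Longrightarrow> thesis"
      show thesis
      proof (cases "\<sigma> \<in> ?A \<or> \<sigma> \<in> (\<lambda>\<sigma>. insert (e \<sigma>) \<sigma>) ` ?A")
        case True
        then show ?thesis using *(2,3) by blast
      next
        case False
        with \<sigma>M have "\<sigma> \<in> critical M ?A e"
          by (simp only: critical_def Diff_iff de_Morgan_disj simp_thms)
        then show ?thesis using *(1) M(4) by simp
      qed
    qed
    then show ?thesis
    proof cases
      case 1
      then show ?thesis using crit by simp
    next
      case 2
      then show ?thesis by simp
    next
      case 3
      then have "card \<sigma> \<le> Suc (card \<tau>)" by (simp add: card_insert_le_m1)
      then show ?thesis using 3 by simp
    qed
  qed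
  define L where "L = M - ?C"
  have L: "abstract_complex L"
    unfolding abstract_complex_def
  proof (intro conjI ballI)
    show "finite L" using finM by (simp add: L_def)
    fix \<sigma> assume \<sigma>: "\<sigma> \<in> L"
    then show "finite \<sigma>" using finM by (simp add: L_def)
    show "Pow \<sigma> \<subseteq> L"
    proof
      fix \<tau> assume \<tau>: "\<tau> \<in> Pow \<sigma>"
      have "\<tau> \<notin> ?C"
      proof
        assume t: "\<tau> \<in> ?C"
        then have "\<tau> \<noteq> \<sigma>" using \<sigma> by (auto simp: L_def)
        then have "card \<tau> < card \<sigma>"
          using \<tau> \<open>finite \<sigma>\<close> by (intro psubset_card_mono) auto
        then show False using crit[OF t] card_M[of \<sigma>] \<sigma> by (simp add: L_def)
      qed
      then show "\<tau> \<in> L" using finM(3)[of \<sigma> \<tau>] \<sigma> \<tau> by (simp add: L_def)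
    qed
  qed
  have matL: "acyclic_matching L ?A e r" and critL: "critical L ?A e = {}"
    using M(3) unfolding L_def M(4)[symmetric] by (auto simp: acyclic_matching_def critical_def)
  obtain P where P: "P \<subseteq> L" "acyclic_matching P {\<sigma>\<in>?A. card \<sigma> < 1} e r" "critical P {\<sigma>\<in>?A. card \<sigma> < 1} e = {}"
    and LP: "geometric_realization L homotopy_equivalent_space geometric_realization P"
    using collapse_above_critical[OF L matL, of 1] critL by auto
  have "{} \<in> A"
  proof (rule ccontr)
    assume "{} \<notin> A"
    then have "{} \<in> ?C" using ne by (auto simp: critical_def)
    then show False using crit by force
  qed
  have "\<sigma> = {}" if "\<sigma> \<in> ?A" "card \<sigma> < 1" for \<sigma>
    using that M(3) finM(2) by (auto simp: acyclic_matching_def)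
  then have A0: "{\<sigma>\<in>?A. card \<sigma> < 1} = {{}}" using \<open>{} \<in> A\<close> by auto
  have Peq: "P = {{}, {e {}}}"
    using P(2,3) unfolding A0 by (auto simp: acyclic_matching_def critical_def)
  have "contractible_space (geometric_realization P)"
    by (simp add: geometric_realization_eq Peq realization_vertex)
  then have contr: "contractible_space (geometric_realization L)"
    using homotopy_equivalent_space_contractibility[OF LP] by simp
  have "realization P \<noteq> {}" by (simp add: Peq realization_vertex)
  then have neL: "realization L \<noteq> {}" using P(1) by (auto simp: realization_def)
  have cells: "M - L = ?C" using M(4) by (auto simp: L_def critical_def)
  obtain F where F: "bij_betw F {..<card ?C} ?C"
    using ex_bij_betw_nat_finite[of ?C] K by (auto simp: critical_def abstract_complex_def lessThan_atLeast0)
  have "geometric_realization M homotopy_equivalent_space wedge_of_spheres (card ?C) d"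
  proof (rule attach_cells_to_contractible[OF M(2) L _ _ _ contr neL])
    show "L \<subseteq> M" by (auto simp: L_def)
    show "bij_betw F {..<card ?C} (M - L)" using F cells by simp
    show "card (F i) = Suc d" if "i < card ?C" for i
      using F that crit by (auto simp: bij_betw_def)
  qed
  then show ?thesis by (rule homotopy_eqv_trans[OF KM])
qed


section \<open>Decision trees\<close>

text \<open>
  A decision tree asks, one vertex at a time, whether the vertex belongs to the set \<open>S \<subseteq> W\<close>. It may stop
  as soon as some remaining vertex \<open>v\<close> does not influence \<open>P\<close>: the sets are then paired off by
  toggling \<open>v\<close>. The third argument collects the sets satisfying \<open>P\<close> that end up unpaired.
\<close>

inductive decision_tree :: "'a set \<Rightarrow> ('a set \<Rightarrow> bool) \<Rightarrow> 'a set set \<Rightarrow> bool" where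
  leaf: "decision_tree {} P {S. S = {} \<and> P S}"
| cone: "v \<notin> W \<Longrightarrow> (\<And>S. S \<subseteq> W \<Longrightarrow> P (insert v S) \<longleftrightarrow> P S) \<Longrightarrow> decision_tree (insert v W) P {}"
| branch: "v \<notin> W \<Longrightarrow> decision_tree W P C\<^sub>0 \<Longrightarrow> decision_tree W (\<lambda>S. P (insert v S)) C\<^sub>1 \<Longrightarrow>
    decision_tree (insert v W) P (C\<^sub>0 \<union> insert v ` C\<^sub>1)"

lemma decision_tree_subset: "decision_tree W P C \<Longrightarrow> C \<subseteq> Pow W"
  by (induction rule: decision_tree.induct) blast+

lemma decision_tree_cong:
  assumes "decision_tree W P C" "\<And>S. S \<subseteq> W \<Longrightarrow> P S \<longleftrightarrow> Q S"
  shows "decision_tree W Q C"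
  using assms
proof (induction arbitrary: Q rule: decision_tree.induct)
  case (leaf P)
  then have "{S. S = {} \<and> P S} = {S. S = {} \<and> Q S}" by auto
  then show ?case using decision_tree.leaf[of Q] by simp
next
  case (cone v W P)
  have "Q (insert v S) \<longleftrightarrow> Q S" if "S \<subseteq> W" for S
    using cone(2)[OF that] cone(3)[of S] cone(3)[of "insert v S"] that by blast
  then show ?case using cone(1) by (intro decision_tree.cone) auto
next
  case (branch v W P C0 C1)
  show ?case
  proof (rule decision_tree.branch[OF branch(1)])
    show "decision_tree W Q C0" by (rule branch.IH) (use branch.prems in blast)
    show "decision_tree W (\<lambda>S. Q (insert v S)) C1" by (rule branch.IH) (use branch.prems in blast)
  qed
qed

text \<open>
  The same tree decides the complement of \<open>S\<close>, with the two outcomes of each question swapped.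
\<close>

lemma decision_tree_complement:
  "decision_tree W P C \<Longrightarrow> decision_tree W (\<lambda>\<sigma>. P (W - \<sigma>)) ((\<lambda>S. W - S) ` C)"
proof (induction rule: decision_tree.induct)
  case (leaf P)
  have "(\<lambda>S. {} - S) ` {S. S = {} \<and> P S} = {\<sigma>. \<sigma> = {} \<and> P ({} - \<sigma>)}" by auto
  then show ?case using decision_tree.leaf[of "\<lambda>\<sigma>. P ({} - \<sigma>)"] by simp
next
  case (cone v W P)
  have "P (insert v W - insert v S) \<longleftrightarrow> P (insert v W - S)" if "S \<subseteq> W" for S
  proof -
    have "insert v W - insert v S = W - S" "insert v W - S = insert v (W - S)"
      using that cone(1) by auto
    then show ?thesis using cone(2)[of "W - S"] by auto
  qed
  then show ?case using cone(1) by (simp add: decision_tree.cone)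
next
  case (branch v W P C0 C1)
  have eq: "insert v W - insert v S = W - S" "insert v W - S = insert v (W - S)" if "S \<subseteq> W" for S
    using that branch(1) by auto
  have "decision_tree W (\<lambda>\<sigma>. P (insert v W - \<sigma>)) ((\<lambda>S. W - S) ` C1)"
    by (rule decision_tree_cong[OF branch(5)]) (simp add: eq)
  moreover have "decision_tree W (\<lambda>\<sigma>. P (insert v W - insert v \<sigma>)) ((\<lambda>S. W - S) ` C0)"
    by (rule decision_tree_cong[OF branch(4)]) (simp add: Diff_insert0[OF branch(1)])
  ultimately have "decision_tree (insert v W) (\<lambda>\<sigma>. P (insert v W - \<sigma>))
      ((\<lambda>S. W - S) ` C1 \<union> insert v ` (\<lambda>S. W - S) ` C0)"
    by (rule decision_tree.branch[OF branch(1)])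
  moreover have "(\<lambda>S. W - S) ` C1 = (\<lambda>S. insert v W - S) ` insert v ` C1"
    unfolding image_image using decision_tree_subset[OF branch(3)] eq(1) by (intro image_cong) auto
  moreover have "insert v ` (\<lambda>S. W - S) ` C0 = (\<lambda>S. insert v W - S) ` C0"
    unfolding image_image using decision_tree_subset[OF branch(2)] eq(2)
    by (intro image_cong refl) (metis PowD subsetD)
  ultimately show ?case by (simp add: image_Un Un_commute)
qed

text \<open>
  At a branch, the matchings for the sets without \<open>v\<close> and for those with \<open>v\<close> are put side by side. A path
  of the combined matching can drop \<open>v\<close> but never gains it again, so it suffices to give the sets
  containing \<open>v\<close> higher ranks than all others.
\<close>

lemma decision_tree_acyclic_matching:
  assumes "decision_tree W P C" "finite W"
  shows "\<exists>A e r. acyclic_matching {S. S \<subseteq> W \<and> P S} A e r \<and> critical {S. S \<subseteq> W \<and> P S} A e = C"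
  using assms
proof (induction rule: decision_tree.induct)
  case (leaf P)
  have "acyclic_matching {S. S \<subseteq> {} \<and> P S} {} e r" for e :: "'a set \<Rightarrow> 'a" and r
    by (simp add: acyclic_matching_def)
  moreover have "critical {S. S \<subseteq> {} \<and> P S} {} e = {S. S = {} \<and> P S}" for e :: "'a set \<Rightarrow> 'a"
    by (simp add: critical_def)
  ultimately show ?case by blast
next
  case (cone v W P)
  let ?A = "{S. S \<subseteq> W \<and> P S}"
  have eq: "{S. S \<subseteq> insert v W \<and> P S} = ?A \<union> insert v ` ?A"
  proof (intro subset_antisym subsetI)
    fix S assume S: "S \<in> {S. S \<subseteq> insert v W \<and> P S}"
    show "S \<in> ?A \<union> insert v ` ?A"
    proof (cases "v \<in> S")
      case True
      then have T: "insert v (S - {v}) = S" "S - {v} \<subseteq> W" using S by auto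
      then have "S - {v} \<in> ?A" using S cone(2)[OF T(2)] by simp
      then have "insert v (S - {v}) \<in> insert v ` ?A" by (rule imageI)
      then show ?thesis unfolding T(1) by blast
    qed (use S in auto)
  qed (use cone(2) in auto)
  have notv: "v \<notin> S" if "S \<in> ?A" for S using that cone(1) by auto
  have "acyclic_matching {S. S \<subseteq> insert v W \<and> P S} ?A (\<lambda>_. v) (\<lambda>_. 0)"
    unfolding acyclic_matching_def eq
  proof (intro conjI ballI impI)
    show "inj_on (insert v) ?A"
      using notv by (auto intro!: inj_onI simp: insert_ident)
    show "0 < (0::nat)" if "S \<in> ?A" "x \<in> S" "insert v S - {x} \<in> ?A" for S x
      using notv[OF that(1)] notv[OF that(3)] that(2) by auto
  qed (use notv cone(1) in auto)
  moreover have "critical {S. S \<subseteq> insert v W \<and> P S} ?A (\<lambda>_. v) = {}"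
    unfolding critical_def eq by auto
  ultimately show ?case by blast
next
  case (branch v W P C0 C1)
  let ?K0 = "{S. S \<subseteq> W \<and> P S}" and ?K1 = "{S. S \<subseteq> W \<and> P (insert v S)}"
  obtain A0 e0 r0 where m0: "acyclic_matching ?K0 A0 e0 r0" and c0: "critical ?K0 A0 e0 = C0"
    using branch by auto
  obtain A1 e1 r1 where m1: "acyclic_matching ?K1 A1 e1 r1" and c1: "critical ?K1 A1 e1 = C1"
    using branch by auto
  define K where "K = {S. S \<subseteq> insert v W \<and> P S}"
  have K: "K = ?K0 \<union> insert v ` ?K1"
  proof (intro subset_antisym subsetI)
    fix S assume S: "S \<in> K"
    show "S \<in> ?K0 \<union> insert v ` ?K1"
    proof (cases "v \<in> S")
      case True
      then have "S = insert v (S - {v})" "S - {v} \<in> ?K1"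
        using S by (auto simp: K_def insert_absorb)
      then show ?thesis by blast
    qed (use S in \<open>auto simp: K_def\<close>)
  qed (auto simp: K_def)
  have K_0: "S \<in> K" if "S \<in> ?K0" for S using that unfolding K by blast
  have K_1: "insert v S \<in> K" if "S \<in> ?K1" for S using that unfolding K by blast
  define A where "A = A0 \<union> insert v ` A1"
  define e where "e S = (if v \<in> S then e1 (S - {v}) else e0 S)" for S
  define r where "r S = (if v \<in> S then Suc (Max (r0 ` A0)) + r1 (S - {v}) else r0 S)" for S
  define up where "up S = insert (e S) S" for S
  define up0 where "up0 S = insert (e0 S) S" for S
  define up1 where "up1 S = insert (e1 S) S" for S
  have A0: "A0 \<subseteq> ?K0" and u0: "\<And>S. S \<in> A0 \<Longrightarrow> e0 S \<notin> S \<and> up0 S \<in> ?K0 - A0" and i0: "inj_on up0 A0"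
    and rk0: "\<And>S x. S \<in> A0 \<Longrightarrow> x \<in> S \<Longrightarrow> up0 S - {x} \<in> A0 \<Longrightarrow> r0 (up0 S - {x}) < r0 S"
    using m0[unfolded acyclic_matching_def, folded up0_def] by (blast, blast, simp, blast)
  have A1: "A1 \<subseteq> ?K1" and u1: "\<And>S. S \<in> A1 \<Longrightarrow> e1 S \<notin> S \<and> up1 S \<in> ?K1 - A1" and i1: "inj_on up1 A1"
    and rk1: "\<And>S x. S \<in> A1 \<Longrightarrow> x \<in> S \<Longrightarrow> up1 S - {x} \<in> A1 \<Longrightarrow> r1 (up1 S - {x}) < r1 S"
    using m1[unfolded acyclic_matching_def, folded up1_def] by (blast, blast, simp, blast)
  have fin0: "finite A0"
    using branch.prems A0 by (auto intro: finite_subset[of A0 "Pow W"])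
  have n0: "v \<notin> S" if "S \<in> ?K0" for S using that branch(1) by auto
  have n1: "v \<notin> S" if "S \<in> ?K1" for S using that branch(1) by auto
  have n0A: "v \<notin> S" if "S \<in> A0" for S using n0 A0 that by blast
  have n1A: "v \<notin> S" if "S \<in> A1" for S using n1 A1 that by blast
  have upA0: "up S = up0 S" if "S \<in> A0" for S
    using n0A[OF that] by (simp add: up_def up0_def e_def)
  have upA1: "up (insert v S) = insert v (up1 S)" if "S \<in> A1" for S
    using n1A[OF that] by (auto simp: up_def up1_def e_def)
  have inA: "T \<in> A0" if "T \<in> A" "v \<notin> T" for T using that by (auto simp: A_def)
  have inA': "T - {v} \<in> A1" if "T \<in> A" "v \<in> T" for T
    using that n0A n1A by (auto simp: A_def)
  have "acyclic_matching K A e r"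
    unfolding acyclic_matching_def up_def[symmetric]
  proof (intro conjI ballI impI)
    show "A \<subseteq> K" unfolding A_def K using A0 A1 by (intro Un_mono image_mono)
    fix S assume S: "S \<in> A"
    show "e S \<notin> S"
    proof (cases "v \<in> S")
      case True
      have a: "S - {v} \<in> A1" by (rule inA'[OF S True])
      have "e1 (S - {v}) \<noteq> v"
        using u1[OF a] n1[of "up1 (S - {v})"] by (auto simp: up1_def)
      then show ?thesis using u1[OF a] True by (simp add: e_def)
    next
      case False
      then show ?thesis using u0[OF inA[OF S False]] by (simp add: e_def)
    qed
    show "up S \<in> K - A"
    proof (cases "v \<in> S")
      case True
      have a: "S - {v} \<in> A1" by (rule inA'[OF S True])
      have "up S = insert v (up1 (S - {v}))" using upA1[OF a] True by (simp add: insert_absorb)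
      moreover have "up1 (S - {v}) \<in> ?K1" "up1 (S - {v}) \<notin> A1" using u1[OF a] by auto
      moreover have "v \<notin> up1 (S - {v})" using n1[OF calculation(2)] .
      ultimately show ?thesis
        using inA'[of "up S"] K_1[of "up1 (S - {v})"] by force
    next
      case False
      have a: "S \<in> A0" by (rule inA[OF S False])
      have "up S \<in> ?K0" "up S \<notin> A0" using u0[OF a] upA0[OF a] by auto
      then show ?thesis using n0[of "up S"] inA[of "up S"] K_0[of "up S"] by blast
    qed
    show "r (up S - {x}) < r S" if x: "x \<in> S" and T: "up S - {x} \<in> A" for x
    proof (cases "v \<in> S")
      case True
      have a: "S - {v} \<in> A1" by (rule inA'[OF S True])
      have upS: "up S = insert v (up1 (S - {v}))" using upA1[OF a] True by (simp add: insert_absorb)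
      show ?thesis
      proof (cases "x = v")
        case True
        then have "up S - {x} \<in> A0" using inA[OF T] by simp
        then have "r0 (up S - {x}) \<le> Max (r0 ` A0)" using fin0 by simp
        then show ?thesis using True \<open>v \<in> S\<close> by (simp add: r_def)
      next
        case False
        have v1: "v \<notin> up1 (S - {v})" using u1[OF a] n1 by blast
        have *: "up S - {x} - {v} = up1 (S - {v}) - {x}"
          using upS v1 False by auto
        have "v \<in> up S - {x}" using upS False by simp
        then have "up1 (S - {v}) - {x} \<in> A1" using inA'[OF T] * by simp
        then have "r1 (up1 (S - {v}) - {x}) < r1 (S - {v})"
          using rk1[OF a] x False by simp
        then show ?thesis using * \<open>v \<in> up S - {x}\<close> \<open>v \<in> S\<close> by (simp add: r_def)
      qed
    next
      case False
      have a: "S \<in> A0" by (rule inA[OF S False])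
      have v0: "v \<notin> up0 S" using u0[OF a] n0 by blast
      then have "up0 S - {x} \<in> A0" using T inA[OF T] upA0[OF a] by simp
      then have "r0 (up0 S - {x}) < r0 S" using rk0[OF a x] by simp
      then show ?thesis using v0 False upA0[OF a] by (simp add: r_def)
    qed
  next
    show "inj_on up A"
    proof (rule inj_onI)
      fix S T assume S: "S \<in> A" and T: "T \<in> A" and eq: "up S = up T"
      have mem: "v \<in> up R \<longleftrightarrow> v \<in> R" if "R \<in> A" for R
      proof (cases "v \<in> R")
        case False
        then show ?thesis using upA0[OF inA[OF that False]] u0[OF inA[OF that False]] n0 by auto
      qed (simp add: up_def)
      show "S = T"
      proof (cases "v \<in> S")
        case True
        then have vT: "v \<in> T" using mem[OF S] mem[OF T] eq by simp
        have a: "S - {v} \<in> A1" "T - {v} \<in> A1" using inA' S T True vT by auto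
        have "insert v (up1 (S - {v})) = insert v (up1 (T - {v}))"
          using upA1[OF a(1)] upA1[OF a(2)] eq True vT by (simp add: insert_absorb)
        then have "up1 (S - {v}) = up1 (T - {v})"
          using u1[OF a(1)] u1[OF a(2)] n1 by (metis (no_types, lifting) Diff_iff insert_ident)
        then have "S - {v} = T - {v}" using i1 a by (auto dest: inj_onD)
        then show ?thesis using True vT by blast
      next
        case False
        then have vT: "v \<notin> T" using mem[OF S] mem[OF T] eq by simp
        show ?thesis
          using i0 inA[OF S False] inA[OF T vT] eq upA0 by (auto dest: inj_onD)
      qed
    qed
  qed
  moreover have "critical K A e = C0 \<union> insert v ` C1"
  proof -
    have upimg: "up ` A = up0 ` A0 \<union> insert v ` up1 ` A1"
      unfolding A_def image_Un image_image using upA0 upA1 by (intro arg_cong2[of _ _ _ _ "(\<union>)"] image_cong) auto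
    have "up0 ` A0 \<subseteq> ?K0" "up1 ` A1 \<subseteq> ?K1" using u0 u1 by auto
    note sub = this A0 A1
    have inj_v: "insert v S = insert v T \<longleftrightarrow> S = T" if "S \<in> ?K1" "T \<in> ?K1" for S T
      using n1[OF that(1)] n1[OF that(2)] by (rule insert_ident)
    have "critical K A e = (?K0 \<union> insert v ` ?K1) - (A0 \<union> insert v ` A1) - (up0 ` A0 \<union> insert v ` up1 ` A1)"
      unfolding critical_def up_def[symmetric] upimg K[symmetric] A_def[symmetric] ..
    also have "\<dots> = (?K0 - A0 - up0 ` A0) \<union> insert v ` (?K1 - A1 - up1 ` A1)"
    proof -
      have split: "(X \<union> Y) - (a \<union> b) - (c \<union> d) = (X - a - c) \<union> (Y - b - d)"
        if "X \<inter> Y = {}" "a \<subseteq> X" "b \<subseteq> Y" "c \<subseteq> X" "d \<subseteq> Y" for X Y a b c d :: "'a set set"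
        using that by blast
      have disj: "?K0 \<inter> insert v ` ?K1 = {}" using n0 by blast
      have "inj_on (insert v) ?K1" using inj_v by (auto intro: inj_onI)
      then have "insert v ` (?K1 - A1 - up1 ` A1) = insert v ` ?K1 - insert v ` A1 - insert v ` up1 ` A1"
        using sub by (simp add: inj_on_image_set_diff[of _ ?K1] Diff_subset subset_trans[OF Diff_subset])
      then show ?thesis
        using split[OF disj sub(3) image_mono[OF sub(4)] sub(1) image_mono[OF sub(2)]] by simp
    qed
    also have "\<dots> = C0 \<union> insert v ` C1"
      using c0 c1 unfolding critical_def up0_def up1_def by simp
    finally show ?thesis .
  qed
  ultimately show ?case unfolding K_def by blast
qed

text \<open>
  The homotopy type depends only on the common size \<open>s\<close> and the number \<open>N\<close> of the unpaired sets.
\<close>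

definition equicritical_tree :: "'a set \<Rightarrow> ('a set \<Rightarrow> bool) \<Rightarrow> nat \<Rightarrow> nat \<Rightarrow> bool" where
  "equicritical_tree W P s N \<longleftrightarrow> (\<exists>C. decision_tree W P C \<and> (\<forall>S\<in>C. card S = s) \<and> card C = N)"

lemma equicritical_tree_cong:
  assumes "equicritical_tree W P s N" "\<And>S. S \<subseteq> W \<Longrightarrow> P S \<longleftrightarrow> Q S"
  shows "equicritical_tree W Q s N"
  using assms decision_tree_cong[of W P _ Q] unfolding equicritical_tree_def by blast

lemma equicritical_tree_cone:
  assumes "v \<in> W" "\<And>S. S \<subseteq> W - {v} \<Longrightarrow> P (insert v S) \<longleftrightarrow> P S"
  shows "equicritical_tree W P s 0"
proof -
  have "decision_tree (insert v (W - {v})) P {}"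
    using assms(2) by (intro decision_tree.cone) auto
  then show ?thesis
    using assms(1) by (auto simp: equicritical_tree_def insert_absorb)
qed

lemma equicritical_tree_branch:
  assumes "finite W" "v \<notin> W"
    and "equicritical_tree W P (Suc s) N\<^sub>0" "equicritical_tree W (\<lambda>S. P (insert v S)) s N\<^sub>1"
  shows "equicritical_tree (insert v W) P (Suc s) (N\<^sub>0 + N\<^sub>1)"
proof -
  obtain C0 where C0: "decision_tree W P C0" "\<forall>S\<in>C0. card S = Suc s" "card C0 = N\<^sub>0"
    using assms(3) by (auto simp: equicritical_tree_def)
  obtain C1 where C1: "decision_tree W (\<lambda>S. P (insert v S)) C1" "\<forall>S\<in>C1. card S = s" "card C1 = N\<^sub>1"
    using assms(4) by (auto simp: equicritical_tree_def)
  have sub: "C0 \<subseteq> Pow W" "C1 \<subseteq> Pow W"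
    using C0(1) C1(1) by (auto dest: decision_tree_subset)
  have v: "v \<notin> S" "finite S" if "S \<in> C0 \<or> S \<in> C1" for S
    using that sub assms(1,2) by (auto intro: finite_subset)
  have fin: "finite C0" "finite C1"
    using sub assms(1) by (auto intro: finite_subset)
  have "inj_on (insert v) C1"
    using v by (intro inj_onI) (simp add: insert_ident)
  moreover have "C0 \<inter> insert v ` C1 = {}"
    using v by blast
  ultimately have "card (C0 \<union> insert v ` C1) = N\<^sub>0 + N\<^sub>1"
    using fin C0(3) C1(3) by (simp add: card_Un_disjoint card_image)
  moreover have "\<forall>S\<in>C0 \<union> insert v ` C1. card S = Suc s"
    using C0(2) C1(2) v by auto
  ultimately show ?thesis
    unfolding equicritical_tree_def using decision_tree.branch[OF assms(2) C0(1) C1(1)] by blast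
qed

text \<open>
  Every question answered positively leads to a cone, until the last vertex \<open>v\<close> leaves \<open>{v}\<close> unpaired.
\<close>

lemma equicritical_tree_nonempty:
  assumes "finite W" "W \<noteq> {}"
  shows "equicritical_tree W (\<lambda>S. S \<noteq> {}) 1 1"
  using assms
proof (induction rule: finite_ne_induct)
  case (singleton v)
  have "equicritical_tree {} (\<lambda>S::'a set. S \<noteq> {}) (Suc 0) 0"
    using decision_tree.leaf[of "\<lambda>S::'a set. S \<noteq> {}"] by (auto simp: equicritical_tree_def)
  moreover have "decision_tree {} (\<lambda>S::'a set. insert v S \<noteq> {}) {{}}"
    using decision_tree.leaf[of "\<lambda>S::'a set. insert v S \<noteq> {}"] by simp
  then have "equicritical_tree {} (\<lambda>S::'a set. insert v S \<noteq> {}) 0 1"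
    unfolding equicritical_tree_def by (intro exI[of _ "{{}}"]) simp
  ultimately show ?case
    using equicritical_tree_branch[of "{}" v "\<lambda>S. S \<noteq> {}" 0 0 1] by simp
next
  case (insert v W)
  obtain w where "w \<in> W" using insert by blast
  then have "equicritical_tree W (\<lambda>S. insert v S \<noteq> {}) 0 0"
    by (rule equicritical_tree_cone) simp
  then show ?case
    using equicritical_tree_branch[of W v "\<lambda>S. S \<noteq> {}" 0 1 0] insert by simp
qed

text \<open>
  The faces are the complements of the sets satisfying \<open>Q\<close>; a critical set of size \<open>s\<close> is therefore the
  complement of a cell with \<open>card V - s\<close> vertices.
\<close>

theorem equicritical_tree_imp_wedge_of_spheres:
  assumes V: "finite V" and tree: "equicritical_tree V Q s N" and s: "s < card V"
    and QV: "Q V" and up: "\<And>S T. Q S \<Longrightarrow> S \<subseteq> T \<Longrightarrow> T \<subseteq> V \<Longrightarrow> Q T"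
  shows "geometric_realization {\<sigma>. \<sigma> \<subseteq> V \<and> Q (V - \<sigma>)} homotopy_equivalent_space
         wedge_of_spheres N (card V - Suc s)"
proof -
  let ?K = "{\<sigma>. \<sigma> \<subseteq> V \<and> Q (V - \<sigma>)}"
  obtain C where C: "decision_tree V Q C" "\<forall>S\<in>C. card S = s" "card C = N"
    using tree by (auto simp: equicritical_tree_def)
  have CV: "C \<subseteq> Pow V" using decision_tree_subset[OF C(1)] .
  obtain A e r where m: "acyclic_matching ?K A e r" "critical ?K A e = (\<lambda>S. V - S) ` C"
    using decision_tree_acyclic_matching[OF decision_tree_complement[OF C(1)] V] by blast
  have "inj_on (\<lambda>S. V - S) C"
    using CV by (intro inj_onI) blast
  then have N: "card (critical ?K A e) = N"
    using C(3) by (simp add: m(2) card_image)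
  have complex: "abstract_complex ?K"
    unfolding abstract_complex_def
  proof (intro conjI ballI)
    show "finite ?K" using V by simp
    show "finite \<sigma>" if "\<sigma> \<in> ?K" for \<sigma> using that V finite_subset by auto
    show "Pow \<sigma> \<subseteq> ?K" if "\<sigma> \<in> ?K" for \<sigma>
    proof
      fix \<tau> assume "\<tau> \<in> Pow \<sigma>"
      then show "\<tau> \<in> ?K"
        using that up[of "V - \<sigma>" "V - \<tau>"] by blast
    qed
  qed
  have empty: "{} \<in> ?K" using QV by simp
  have dim: "card \<sigma> = Suc (card V - Suc s)" if "\<sigma> \<in> critical ?K A e" for \<sigma>
  proof -
    have "\<sigma> \<in> (\<lambda>S. V - S) ` C" using that by (simp only: m(2))
    then obtain S where S: "S \<in> C" "\<sigma> = V - S" by blast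
    then have "card \<sigma> = card V - s"
      using C(2) CV V by (subst S(2), subst card_Diff_subset) (auto intro: finite_subset)
    then show ?thesis using s by simp
  qed
  show ?thesis
    using acyclic_matching_imp_wedge_of_spheres[OF complex empty m(1) dim] by (simp only: N)
qed


section \<open>Independent sets\<close>

definition has_indep :: "('a \<Rightarrow> 'a \<Rightarrow> bool) \<Rightarrow> nat \<Rightarrow> 'a set \<Rightarrow> bool" where
  "has_indep E k S \<longleftrightarrow> (\<exists>T\<subseteq>S. card T = k \<and> (\<forall>u\<in>T. \<forall>v\<in>T. \<not> E u v))"

lemma total_cut_complex_eq:
  "total_cut_complex k V E = {\<sigma>. \<sigma> \<subseteq> V \<and> has_indep E k (V - \<sigma>)}"
proof -
  have "has_indep E k (V - \<sigma>) \<longleftrightarrow> (\<exists>S\<subseteq>V - \<sigma>. independent_set V E S \<and> card S = k)" for \<sigma>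
    unfolding has_indep_def independent_set_def by (rule iff_exI) blast
  then show ?thesis by (simp only: set_eq_iff mem_total_cut_complex_iff mem_Collect_eq simp_thms)
qed

lemma has_indep_mono: "has_indep E k S \<Longrightarrow> S \<subseteq> T \<Longrightarrow> has_indep E k T"
  unfolding has_indep_def by blast

lemma has_indepI:
  assumes "T \<subseteq> S" "k \<le> card T" "\<And>u v. u \<in> T \<Longrightarrow> v \<in> T \<Longrightarrow> \<not> E u v"
  shows "has_indep E k S"
proof -
  obtain T' where "T' \<subseteq> T" "card T' = k"
    using obtain_subset_with_card_n[OF assms(2)] by metis
  then show ?thesis
    using assms unfolding has_indep_def by (intro exI[of _ T']) blast
qed

lemma has_indep_0: "has_indep E 0 S"
  unfolding has_indep_def by (intro exI[of _ "{}"]) simp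

lemma has_indep_1:
  assumes "irreflp E"
  shows "has_indep E (Suc 0) S \<longleftrightarrow> S \<noteq> {}"
proof
  assume "S \<noteq> {}"
  then obtain v where "v \<in> S" by blast
  then show "has_indep E (Suc 0) S"
    using assms by (intro has_indepI[of "{v}"]) (auto dest: irreflpD)
qed (auto simp: has_indep_def)

lemma not_has_indep_Suc_empty: "\<not> has_indep E (Suc k) {}"
  by (simp add: has_indep_def)

text \<open>
  If \<open>w\<close> is the only neighbour of \<open>z\<close>, then \<open>w\<close> can be replaced by \<open>z\<close> in any independent set.
\<close>

lemma has_indep_insert_neighbour_of_leaf:
  assumes "symp E" "finite S" "z \<in> S" "w \<notin> S" "E z w" and leaf: "\<And>u. u \<in> S \<Longrightarrow> \<not> E z u"
  shows "has_indep E k (insert w S) \<longleftrightarrow> has_indep E k S"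
proof
  assume "has_indep E k (insert w S)"
  then obtain T where T: "T \<subseteq> insert w S" "card T = k" "\<And>u v. u \<in> T \<Longrightarrow> v \<in> T \<Longrightarrow> \<not> E u v"
    unfolding has_indep_def by blast
  show "has_indep E k S"
  proof (cases "w \<in> T")
    case True
    have fin: "finite T" using T(1) assms(2) by (auto intro: finite_subset)
    have "z \<notin> T" using T(3)[of z w] True assms(5) by blast
    then have "card (insert z (T - {w})) = Suc (card (T - {w}))"
      using fin by simp
    also have "\<dots> = k" using card_Suc_Diff1[OF fin True] T(2) by simp
    finally have "card (insert z (T - {w})) = k" .
    moreover have "\<not> E u v" if "u \<in> insert z (T - {w})" "v \<in> insert z (T - {w})" for u v
    proof -
      have "\<not> E z x \<and> \<not> E x z" if "x \<in> S" for x
        using leaf[OF that] assms(1) by (auto dest: sympD)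
      then show ?thesis using that T(1,3) assms(3) by blast
    qed
    moreover have "insert z (T - {w}) \<subseteq> S" using T(1) assms(3) by blast
    ultimately show ?thesis by (intro has_indepI[of "insert z (T - {w})"]) auto
  next
    case False
    then show ?thesis using T by (intro has_indepI[of T]) auto
  qed
qed (auto intro: has_indep_mono)

text \<open>
  An independent set contains at most one end of the edge. Conversely, an independent subset of \<open>S\<close>
  contains at most one of the adjacent vertices \<open>w\<^sub>1\<close> and \<open>w\<^sub>2\<close>, so one end of the edge can be added.
\<close>

lemma has_indep_insert_edge:
  assumes "symp E" "irreflp E" "finite S" "z\<^sub>1 \<notin> S" "z\<^sub>2 \<notin> S" "E z\<^sub>1 z\<^sub>2" "E w\<^sub>1 w\<^sub>2"
    and n1: "\<And>u. u \<in> S \<Longrightarrow> E z\<^sub>1 u \<Longrightarrow> u = w\<^sub>1" and n2: "\<And>u. u \<in> S \<Longrightarrow> E z\<^sub>2 u \<Longrightarrow> u = w\<^sub>2"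
  shows "has_indep E (Suc k) (insert z\<^sub>1 (insert z\<^sub>2 S)) \<longleftrightarrow> has_indep E k S"
proof
  assume "has_indep E (Suc k) (insert z\<^sub>1 (insert z\<^sub>2 S))"
  then obtain T where T: "T \<subseteq> insert z\<^sub>1 (insert z\<^sub>2 S)" "card T = Suc k"
    "\<And>u v. u \<in> T \<Longrightarrow> v \<in> T \<Longrightarrow> \<not> E u v"
    unfolding has_indep_def by blast
  have fin: "finite T" using T(2) by (intro card_ge_0_finite) simp
  obtain z where z: "T - {z} \<subseteq> S"
    using T(1) T(3)[of "z\<^sub>1" "z\<^sub>2"] assms(6) by blast
  have "k \<le> card (T - {z})"
    using T(2) fin by (cases "z \<in> T") auto
  then show "has_indep E k S"
    using z T(3) by (intro has_indepI[of "T - {z}"]) auto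
next
  assume "has_indep E k S"
  then obtain T where T: "T \<subseteq> S" "card T = k" "\<And>u v. u \<in> T \<Longrightarrow> v \<in> T \<Longrightarrow> \<not> E u v"
    unfolding has_indep_def by blast
  have fin: "finite T" using T(1) assms(3) finite_subset by blast
  obtain z where z: "z = z\<^sub>1 \<or> z = z\<^sub>2" "\<And>u. u \<in> T \<Longrightarrow> \<not> E z u"
    using n1 n2 T(1,3) assms(7) by (metis subsetD)
  have "z \<notin> T" using z(1) T(1) assms(4,5) by blast
  then have "Suc k \<le> card (insert z T)"
    using T(2) fin by simp
  moreover have "\<not> E u v" if "u \<in> insert z T" "v \<in> insert z T" for u v
    using that z(2) T(3) assms(1,2) by (auto dest: sympD irreflpD)
  ultimately show "has_indep E (Suc k) (insert z\<^sub>1 (insert z\<^sub>2 S))"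
    using z(1) T(1) by (intro has_indepI[of "insert z T"]) auto
qed


section \<open>Decision trees for grid graphs\<close>

abbreviation grid_indep :: "nat \<Rightarrow> (nat \<times> nat) set \<Rightarrow> bool" where
  "grid_indep \<equiv> has_indep grid_adj"

lemmas grid_leaf = has_indep_insert_neighbour_of_leaf[OF symp_grid_adj]
lemmas grid_edge = has_indep_insert_edge[OF symp_grid_adj irreflp_grid_adj]

lemma grid_vertices_2_Suc:
  "grid_vertices 2 (Suc n) = insert (1, Suc n) (insert (2, Suc n) (grid_vertices 2 n))"
proof -
  have "{1..2} = {1, 2 :: nat}" "{1..Suc n} = insert (Suc n) {1..n}" by auto
  then show ?thesis unfolding grid_vertices_def by blast
qed

lemma grid_vertices_3_Suc:
  "grid_vertices 3 (Suc n) = insert (1, Suc n) (insert (2, Suc n) (insert (3, Suc n) (grid_vertices 3 n)))"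
proof -
  have "{1..3} = {1, 2, 3 :: nat}" "{1..Suc n} = insert (Suc n) {1..n}" by auto
  then show ?thesis unfolding grid_vertices_def by blast
qed

lemma grid_vertices_0: "grid_vertices m 0 = {}"
  by (simp add: grid_vertices_def)

text \<open>
  \<open>Z\<close> is the part of the set in the last column. A vertex that is isolated within \<open>Z\<close> has at most one
  neighbour, the vertex before it in the same row.
\<close>

lemma grid_column_irrelevant_neighbour:
  assumes "S \<subseteq> grid_vertices m (Suc n) - {(i, Suc n)}" "i \<in> {1..m}"
    and "Z \<subseteq> {1..m} \<times> {Suc (Suc n)}" "(i, Suc (Suc n)) \<in> Z"
    and "\<And>u. u \<in> Z \<Longrightarrow> \<not> grid_adj (i, Suc (Suc n)) u"
  shows "grid_indep k (Z \<union> insert (i, Suc n) S) \<longleftrightarrow> grid_indep k (Z \<union> S)"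
proof -
  have "finite S" "finite Z"
    using assms(1,3) finite_grid_vertices[of m "Suc n"] by (auto intro: finite_subset)
  moreover have "(i, Suc n) \<notin> Z \<union> S" using assms(1,3) by auto
  moreover have "\<not> grid_adj (i, Suc (Suc n)) u" if "u \<in> Z \<union> S" for u
  proof (cases "u \<in> Z")
    case True
    then show ?thesis by (rule assms(5))
  next
    case False
    then show ?thesis
      using that assms(1) by (cases u) (auto simp: grid_adj_def grid_vertices_def)
  qed
  ultimately have "grid_indep k (insert (i, Suc n) (Z \<union> S)) \<longleftrightarrow> grid_indep k (Z \<union> S)"
    using assms(4) by (intro grid_leaf[of _ "(i, Suc (Suc n))"]) (auto simp: grid_adj_def)
  then show ?thesis by simp
qed

text \<open>
  The neighbours of two adjacent vertices in the previous column are adjacent as well. For \<open>n = 0\<close> they lie outside the grid, and \<open>S\<close> is empty.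
\<close>

lemma grid_column_edge:
  assumes "S \<subseteq> grid_vertices m n" "i = Suc j \<or> j = Suc i"
  shows "grid_indep (Suc k) (insert (i, Suc n) (insert (j, Suc n) S)) \<longleftrightarrow> grid_indep k S"
proof (rule grid_edge[where w\<^sub>1 = "(i, n)" and w\<^sub>2 = "(j, n)"])
  show "finite S" using assms(1) finite_grid_vertices by (rule finite_subset)
qed (use assms in \<open>auto simp: grid_adj_def grid_vertices_def\<close>)

lemma equicritical_tree_grid_1:
  assumes "1 \<le> m"
  shows "equicritical_tree (grid_vertices m (Suc n)) (grid_indep (Suc 0)) 1 1"
proof (rule equicritical_tree_cong)
  show "equicritical_tree (grid_vertices m (Suc n)) (\<lambda>S. S \<noteq> {}) 1 1"
    using assms by (intro equicritical_tree_nonempty finite_grid_vertices) (auto simp: grid_vertices_def)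
qed (simp add: has_indep_1 irreflp_grid_adj)

text \<open>
  Reading the last column, a single vertex gives a cone, an empty column the tree for \<open>n\<close> columns, and a
  full column the tree for \<open>n\<close> columns with \<open>k\<close> lowered by one. This is the recursion of the binomial
  coefficients.
\<close>

lemma equicritical_tree_grid_2:
  "equicritical_tree (grid_vertices 2 (Suc n)) (grid_indep (Suc k)) (2 * k + 1) (n choose k)"
proof (induction n arbitrary: k)
  case 0
  show ?case
  proof (cases k)
    case 0
    then show ?thesis using equicritical_tree_grid_1[of 2 0] by simp
  next
    case (Suc j)
    have no: "\<not> grid_indep (Suc (Suc j)) S" if "S \<subseteq> grid_vertices 2 (Suc 0)" for S
    proof
      assume "grid_indep (Suc (Suc j)) S"
      then have "grid_indep (Suc (Suc j)) (insert (1, Suc 0) (insert (2, Suc 0) {}))"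
        by (rule has_indep_mono) (use that in \<open>simp add: grid_vertices_2_Suc grid_vertices_0\<close>)
      then show False
        by (simp add: grid_column_edge not_has_indep_Suc_empty)
    qed
    have "equicritical_tree (grid_vertices 2 (Suc 0)) (grid_indep (Suc (Suc j))) (2 * k + 1) 0"
    proof (rule equicritical_tree_cone[of "(1, 1)"])
      show "(1, 1) \<in> grid_vertices 2 (Suc 0)" by (simp add: grid_vertices_def)
      show "grid_indep (Suc (Suc j)) (insert (1, 1) S) \<longleftrightarrow> grid_indep (Suc (Suc j)) S"
        if "S \<subseteq> grid_vertices 2 (Suc 0) - {(1, 1)}" for S
        using that no[of S] no[of "insert (1, 1) S"] by (auto simp: grid_vertices_def)
    qed
    then show ?thesis using Suc by simp
  qed
next
  case (Suc n)
  show ?case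
  proof (cases k)
    case 0
    then show ?thesis using equicritical_tree_grid_1[of 2 "Suc n"] by simp
  next
    case k: (Suc j)
    let ?W = "grid_vertices 2 (Suc n)"
    let ?z1 = "(1, Suc (Suc n)) :: nat \<times> nat" and ?z2 = "(2, Suc (Suc n)) :: nat \<times> nat"
    have single: "equicritical_tree ?W (\<lambda>S. grid_indep (Suc k) (insert (i, Suc (Suc n)) S)) s 0"
      if "i \<in> {1..2}" for i s
    proof (rule equicritical_tree_cone[of "(i, Suc n)"])
      show "(i, Suc n) \<in> ?W" using that by (auto simp: grid_vertices_def)
      fix S assume S: "S \<subseteq> ?W - {(i, Suc n)}"
      show "grid_indep (Suc k) (insert (i, Suc (Suc n)) (insert (i, Suc n) S)) \<longleftrightarrow>
          grid_indep (Suc k) (insert (i, Suc (Suc n)) S)"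
        using grid_column_irrelevant_neighbour[OF S, of "{(i, Suc (Suc n))}" "Suc k"] that
        by (simp add: grid_adj_def insert_commute)
    qed
    have notin: "?z1 \<notin> insert ?z2 ?W" "?z2 \<notin> ?W" by (auto simp: grid_vertices_def)
    have fin: "finite ?W" by (rule finite_grid_vertices)
    have IH1: "equicritical_tree ?W (grid_indep (Suc k)) (Suc (2 * k)) (n choose k)"
      using Suc.IH[of k] by simp
    have IH2: "equicritical_tree ?W (\<lambda>S. grid_indep (Suc k) (insert ?z1 (insert ?z2 S))) (2 * j + 1) (n choose j)"
      unfolding k by (rule equicritical_tree_cong[OF Suc.IH[of j]]) (simp add: grid_column_edge)
    have "equicritical_tree (insert ?z2 ?W) (grid_indep (Suc k)) (Suc (2 * k)) ((n choose k) + 0)"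
      by (rule equicritical_tree_branch[OF fin notin(2) IH1 single]) simp
    moreover have "equicritical_tree (insert ?z2 ?W) (\<lambda>S. grid_indep (Suc k) (insert ?z1 S))
        (Suc (2 * j + 1)) (0 + (n choose j))"
      by (rule equicritical_tree_branch[OF fin notin(2) single IH2]) simp
    moreover have "Suc (2 * j + 1) = 2 * k" by (simp add: k)
    moreover have "finite (insert ?z2 ?W)" using fin by simp
    ultimately have "equicritical_tree (insert ?z1 (insert ?z2 ?W)) (grid_indep (Suc k)) (Suc (2 * k))
        (((n choose k) + 0) + (0 + (n choose j)))"
      using equicritical_tree_branch[OF _ notin(1)] by metis
    then show ?thesis
      by (simp add: k grid_vertices_2_Suc[of "Suc n"] add.commute)
  qed
qed

lemma grid_indep_2: "k \<le> n \<Longrightarrow> grid_indep k (grid_vertices 2 n)"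
proof (induction n arbitrary: k)
  case (Suc n)
  show ?case
  proof (cases k)
    case (Suc j)
    have "grid_indep (Suc j) (insert (1, Suc n) (insert (2, Suc n) (grid_vertices 2 n)))
        \<longleftrightarrow> grid_indep j (grid_vertices 2 n)"
      by (rule grid_column_edge) auto
    then show ?thesis
      using Suc Suc.IH[of j] Suc.prems unfolding grid_vertices_2_Suc by simp
  qed (simp add: has_indep_0)
qed (simp add: has_indep_0)

text \<open>
  The eight possible contents of the last column: the empty one and the full one appear as assumptions,
  the two edges lower \<open>k\<close> by one, and each of the remaining four contains an isolated vertex, hence
  gives a cone.
\<close>

lemma equicritical_tree_grid_3_column:
  fixes n :: nat
  defines "W \<equiv> grid_vertices 3 (Suc n)" and "z \<equiv> \<lambda>i. (i, Suc (Suc n))"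
  assumes empty: "equicritical_tree W (grid_indep (Suc k)) (Suc (Suc (Suc s))) N\<^sub>0"
    and edge: "equicritical_tree W (grid_indep k) (Suc s) N\<^sub>1"
    and full: "equicritical_tree W (\<lambda>S. grid_indep (Suc k) (insert (z 1) (insert (z 2) (insert (z 3) S)))) s N\<^sub>2"
  shows "equicritical_tree (grid_vertices 3 (Suc (Suc n))) (grid_indep (Suc k)) (Suc (Suc (Suc s)))
           (N\<^sub>0 + 2 * N\<^sub>1 + N\<^sub>2)"
proof -
  let ?P = "grid_indep (Suc k)"
  have cone: "equicritical_tree W (\<lambda>S. ?P (z ` J \<union> S)) t 0"
    if J: "i \<in> J" "J \<subseteq> {1..3}" and nonadj: "\<And>j. j \<in> J \<Longrightarrow> j \<noteq> Suc i \<and> i \<noteq> Suc j" for i J t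
  proof (rule equicritical_tree_cone[of "(i, Suc n)"])
    show "(i, Suc n) \<in> W" using J by (auto simp: grid_vertices_def W_def)
    fix S assume S: "S \<subseteq> W - {(i, Suc n)}"
    have "\<not> grid_adj (i, Suc (Suc n)) u" if u: "u \<in> z ` J" for u
    proof -
      obtain j where j: "j \<in> J" "u = z j" using u by blast
      show ?thesis using nonadj[OF j(1)] j(2) by (simp add: grid_adj_def z_def)
    qed
    then show "?P (z ` J \<union> insert (i, Suc n) S) \<longleftrightarrow> ?P (z ` J \<union> S)"
      using S J unfolding W_def
      by (intro grid_column_irrelevant_neighbour) (auto simp: z_def)
  qed
  have c1: "equicritical_tree W (\<lambda>S. ?P (insert (z 1) S)) t 0" for t
    using cone[of 1 "{1}" t] by simp
  have c2: "equicritical_tree W (\<lambda>S. ?P (insert (z 2) S)) t 0" for t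
    using cone[of 2 "{2}" t] by simp
  have c3: "equicritical_tree W (\<lambda>S. ?P (insert (z 3) S)) t 0" for t
    using cone[of 3 "{3}" t] by simp
  have c13: "equicritical_tree W (\<lambda>S. ?P (insert (z 1) (insert (z 3) S))) t 0" for t
  proof -
    have "equicritical_tree W (\<lambda>S. ?P (z ` {1, 3} \<union> S)) t 0"
      by (rule cone[of 1]) auto
    then show ?thesis by simp
  qed
  have e12: "equicritical_tree W (\<lambda>S. ?P (insert (z 1) (insert (z 2) S))) (Suc s) N\<^sub>1"
    by (rule equicritical_tree_cong[OF edge]) (simp add: grid_column_edge z_def W_def)
  have e23: "equicritical_tree W (\<lambda>S. ?P (insert (z 2) (insert (z 3) S))) (Suc s) N\<^sub>1"
    by (rule equicritical_tree_cong[OF edge]) (simp add: grid_column_edge z_def W_def)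
  have fin: "finite W" by (simp add: W_def finite_grid_vertices)
  have notin: "z 3 \<notin> W" "z 2 \<notin> insert (z 3) W" "z 1 \<notin> insert (z 2) (insert (z 3) W)"
    by (auto simp: W_def z_def grid_vertices_def)
  note b3 = equicritical_tree_branch[OF fin notin(1)]
  have "finite (insert (z 3) W)" using fin by simp
  note b2 = equicritical_tree_branch[OF this notin(2)]
  have "finite (insert (z 2) (insert (z 3) W))" using fin by simp
  note b1 = equicritical_tree_branch[OF this notin(3)]
  have "equicritical_tree (insert (z 1) (insert (z 2) (insert (z 3) W))) ?P (Suc (Suc (Suc s)))
      (((N\<^sub>0 + 0) + (0 + N\<^sub>1)) + ((0 + 0) + (N\<^sub>1 + N\<^sub>2)))"
    by (rule b1[OF b2[OF b3[OF empty c3] b3[OF c2 e23]] b2[OF b3[OF c1 c13] b3[OF e12 full]]])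
  then show ?thesis
    by (simp add: grid_vertices_3_Suc[of "Suc n"] W_def z_def mult_2 add.assoc)
qed

text \<open>
  The middle vertex is adjacent to the other two, so it is useless for independent sets of at least two vertices.
\<close>

lemma equicritical_tree_grid_3_single_column:
  assumes "2 \<le> k"
  shows "equicritical_tree (grid_vertices 3 (Suc 0)) (grid_indep k) s 0"
proof (rule equicritical_tree_cone[of "(2, 1)"])
  show "(2, 1) \<in> grid_vertices 3 (Suc 0)" by (simp add: grid_vertices_def)
  fix S assume S: "S \<subseteq> grid_vertices 3 (Suc 0) - {(2, 1)}"
  show "grid_indep k (insert (2, 1) S) \<longleftrightarrow> grid_indep k S"
  proof
    assume "grid_indep k (insert (2, 1) S)"
    then obtain T where T: "T \<subseteq> insert (2, 1) S" "card T = k" "\<And>u v. u \<in> T \<Longrightarrow> v \<in> T \<Longrightarrow> \<not> grid_adj u v"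
      unfolding has_indep_def by blast
    have "(2, 1) \<notin> T"
    proof
      assume 2: "(2, 1) \<in> T"
      have "T \<subseteq> {(2, 1)}"
      proof
        fix u assume u: "u \<in> T"
        then have "\<not> grid_adj (2, 1) u" using T(3) 2 by blast
        then show "u \<in> {(2, 1)}"
          using u T(1) S by (auto simp: grid_vertices_3_Suc grid_vertices_0 grid_adj_def)
      qed
      then have "card T \<le> 1" using card_mono[of "{(2, 1)}" T] by simp
      then show False using T(2) assms by simp
    qed
    then show "grid_indep k S" using T by (intro has_indepI[of T]) auto
  qed (auto intro: has_indep_mono)
qed

lemma equicritical_tree_grid_3_2:
  "equicritical_tree (grid_vertices 3 (Suc n)) (grid_indep 2) 3 (2 * n)"
proof (induction n)
  case 0
  show ?case using equicritical_tree_grid_3_single_column[of 2] by simp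
next
  case (Suc n)
  have "equicritical_tree (grid_vertices 3 (Suc n))
     (\<lambda>S. grid_indep (Suc 1) (insert (1, Suc (Suc n)) (insert (2, Suc (Suc n)) (insert (3, Suc (Suc n)) S)))) 0 0"
  proof (rule equicritical_tree_cone[of "(1, 1)"])
    have "grid_indep (Suc 1) (insert (1, Suc (Suc n)) (insert (2, Suc (Suc n)) (insert (3, Suc (Suc n)) S)))" for S
      by (rule has_indepI[of "{(1, Suc (Suc n)), (3, Suc (Suc n))}"]) (auto simp: grid_adj_def)
    then show "grid_indep (Suc 1) (insert (1, Suc (Suc n)) (insert (2, Suc (Suc n)) (insert (3, Suc (Suc n)) (insert (1, 1) S)))) \<longleftrightarrow>
        grid_indep (Suc 1) (insert (1, Suc (Suc n)) (insert (2, Suc (Suc n)) (insert (3, Suc (Suc n)) S)))" for S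
      by blast
  qed (simp add: grid_vertices_def)
  then show ?case
    using equicritical_tree_grid_3_column[of n 1 0 "2 * n" 1 0] Suc.IH equicritical_tree_grid_1[of 3 n]
    by (simp add: numeral_2_eq_2 numeral_3_eq_3)
qed

text \<open>
  With a full last column, the two outer vertices and any vertex not adjacent to them are independent. So the
  condition can fail only for subsets of \<open>{a, c}\<close>, the neighbours of the outer vertices; it fails for the
  proper subsets, and holds for \<open>{a, c}\<close> itself together with the middle vertex. Without \<open>c\<close> it is
  independent of \<open>a\<close>, and with \<open>c\<close> it says that some further vertex is present.
\<close>

lemma equicritical_tree_grid_3_3_full_column:
  "equicritical_tree (grid_vertices 3 (Suc n))
     (\<lambda>S. grid_indep 3 (insert (1, Suc (Suc n)) (insert (2, Suc (Suc n)) (insert (3, Suc (Suc n)) S)))) 2 1"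
proof -
  define z where "z i = (i, Suc (Suc n))" for i :: nat
  define a where "a = (1 :: nat, Suc n)"
  define c where "c = (3 :: nat, Suc n)"
  define P where "P S = grid_indep 3 (insert (z 1) (insert (z 2) (insert (z 3) S)))" for S
  let ?W = "grid_vertices 3 (Suc n)"
  have far: "P S" if "r \<in> S" "r \<in> ?W" "r \<noteq> a" "r \<noteq> c" for r S
    unfolding P_def
  proof (rule has_indepI[of "{z 1, z 3, r}"])
    have "card {z 1, z 3, r} = 3"
      using that(2) by (auto simp: z_def grid_vertices_def)
    then show "3 \<le> card {z 1, z 3, r}" by simp
    obtain p q where r: "r = (p, q)" by (cases r)
    have "\<not> grid_adj (z 1) r" "\<not> grid_adj (z 3) r" "\<not> grid_adj (z 1) (z 3)"
      using that(2-4) by (auto simp: r z_def a_def c_def grid_adj_def grid_vertices_def)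
    then show "\<not> grid_adj u v" if "u \<in> {z 1, z 3, r}" "v \<in> {z 1, z 3, r}" for u v
      using that sympD[OF symp_grid_adj] irreflpD[OF irreflp_grid_adj] by blast
  qed (use that(1) in auto)
  have both: "P S" if "a \<in> S" "c \<in> S" for S
    unfolding P_def
    by (rule has_indepI[of "{a, c, z 2}"]) (use that in \<open>auto simp: z_def a_def c_def grid_adj_def\<close>)
  have not_a: "\<not> P {a}"
  proof -
    have "grid_indep 3 (insert (z 2) (insert (z 3) {z 1, a})) \<longleftrightarrow> grid_indep 2 {z 1, a}"
      unfolding numeral_3_eq_3 numeral_2_eq_2
      by (rule grid_edge[where w\<^sub>1 = "z 1" and w\<^sub>2 = a]) (auto simp: z_def a_def grid_adj_def)
    \<comment> \<open>Here the rest of the graph is empty, so any edge serves as \<open>w\<^sub>1\<close>, \<open>w\<^sub>2\<close>.\<close>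
    also have "grid_indep 2 {z 1, a} \<longleftrightarrow> grid_indep 1 {}"
      unfolding numeral_2_eq_2 One_nat_def
      by (rule grid_edge[where w\<^sub>1 = "z 1" and w\<^sub>2 = a]) (auto simp: z_def a_def grid_adj_def)
    finally show ?thesis
      by (simp add: P_def not_has_indep_Suc_empty insert_commute)
  qed
  have not_c: "\<not> P {c}"
  proof -
    have "grid_indep 3 (insert (z 2) (insert (z 1) {z 3, c})) \<longleftrightarrow> grid_indep 2 {z 3, c}"
      unfolding numeral_3_eq_3 numeral_2_eq_2
      by (rule grid_edge[where w\<^sub>1 = "z 3" and w\<^sub>2 = c]) (auto simp: z_def c_def grid_adj_def)
    also have "grid_indep 2 {z 3, c} \<longleftrightarrow> grid_indep 1 {}"
      unfolding numeral_2_eq_2 One_nat_def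
      by (rule grid_edge[where w\<^sub>1 = "z 3" and w\<^sub>2 = c]) (auto simp: z_def c_def grid_adj_def)
    finally show ?thesis
      by (simp add: P_def not_has_indep_Suc_empty insert_commute)
  qed
  have mono: "P T" if "P S" "S \<subseteq> T" for S T
    using that(1) unfolding P_def by (rule has_indep_mono) (use that(2) in blast)
  have ac: "a \<in> ?W - {c}" "c \<in> ?W" by (auto simp: a_def c_def grid_vertices_def)
  have "equicritical_tree (?W - {c}) P (Suc 1) 0"
  proof (rule equicritical_tree_cone[OF ac(1)])
    fix S assume S: "S \<subseteq> ?W - {c} - {a}"
    show "P (insert a S) \<longleftrightarrow> P S"
    proof (cases "S = {}")
      case True
      then show ?thesis using not_a mono[of "{}" "{a}"] by auto
    next
      case False
      then obtain r where "r \<in> S" by blast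
      then show ?thesis using far[of r S] far[of r "insert a S"] S by blast
    qed
  qed
  moreover have "equicritical_tree (?W - {c}) (\<lambda>S. P (insert c S)) 1 1"
  proof (rule equicritical_tree_cong)
    show "equicritical_tree (?W - {c}) (\<lambda>S. S \<noteq> {}) 1 1"
      using ac(1) by (intro equicritical_tree_nonempty) (auto simp: finite_grid_vertices)
    fix S assume S: "S \<subseteq> ?W - {c}"
    show "S \<noteq> {} \<longleftrightarrow> P (insert c S)"
    proof (cases "S = {}")
      case True
      then show ?thesis using not_c by simp
    next
      case False
      then obtain r where "r \<in> S" by blast
      then have "P (insert c S)"
        using S far[of r "insert c S"] both[of "insert c S"] by (cases "r = a") blast+
      then show ?thesis using False by simp
    qed
  qed
  ultimately have "equicritical_tree (insert c (?W - {c})) P (Suc 1) (0 + 1)"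
    by (intro equicritical_tree_branch) (auto simp: finite_grid_vertices)
  then show ?thesis
    using ac(2) by (simp add: insert_absorb P_def[abs_def] z_def numeral_2_eq_2)
qed

lemma equicritical_tree_grid_3_3:
  "equicritical_tree (grid_vertices 3 (Suc n)) (grid_indep 3) 5 (2 * n choose 2)"
proof (induction n)
  case 0
  show ?case using equicritical_tree_grid_3_single_column[of 3] by (simp add: binomial_eq_0)
next
  case (Suc n)
  have "equicritical_tree (grid_vertices 3 (Suc (Suc n))) (grid_indep (Suc 2)) (Suc (Suc (Suc 2)))
      ((2 * n choose 2) + 2 * (2 * n) + 1)"
  proof (rule equicritical_tree_grid_3_column)
    show "equicritical_tree (grid_vertices 3 (Suc n)) (grid_indep (Suc 2)) (Suc (Suc (Suc 2))) (2 * n choose 2)"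
      using Suc.IH by (simp add: eval_nat_numeral)
    show "equicritical_tree (grid_vertices 3 (Suc n)) (grid_indep 2) (Suc 2) (2 * n)"
      using equicritical_tree_grid_3_2[of n] by (simp add: eval_nat_numeral)
    show "equicritical_tree (grid_vertices 3 (Suc n))
       (\<lambda>S. grid_indep (Suc 2) (insert (1, Suc (Suc n)) (insert (2, Suc (Suc n)) (insert (3, Suc (Suc n)) S)))) 2 1"
      using equicritical_tree_grid_3_3_full_column[of n] by (simp add: eval_nat_numeral)
  qed
  \<comment> \<open>Pascal's rule, applied twice.\<close>
  moreover have "(2 * n choose 2) + 2 * (2 * n) + 1 = 2 * Suc n choose 2"
    by (simp add: numeral_2_eq_2)
  moreover have "Suc 2 = 3" "Suc (Suc (Suc 2)) = 5" by simp_all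
  ultimately show ?case by (simp only:)
qed

theorem theorem1p1:
  shows "(\<forall>n k :: nat. 2 \<le> k \<and> k \<le> n \<longrightarrow>
            geometric_realization (total_cut_complex k (grid_vertices 2 n) grid_adj)
              homotopy_equivalent_space
            wedge_of_spheres ((n - 1) choose (k - 1)) (2 * n - 2 * k)) \<and>
         (\<forall>n :: nat. 2 \<le> n \<longrightarrow>
            geometric_realization (total_cut_complex 3 (grid_vertices 3 n) grid_adj)
              homotopy_equivalent_space
            wedge_of_spheres ((2 * n - 2) choose 2) (3 * n - 6))"
proof (intro conjI allI impI)
  fix n k :: nat
  assume nk: "2 \<le> k \<and> k \<le> n"
  then obtain n' k' where n': "n = Suc n'" and k': "k = Suc k'"
    by (metis Suc_le_D numeral_2_eq_2 order_trans)
  have card: "card (grid_vertices 2 n) = 2 * n" by (simp add: grid_vertices_def)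
  have "geometric_realization (total_cut_complex k (grid_vertices 2 n) grid_adj)
      homotopy_equivalent_space wedge_of_spheres (n' choose k') (card (grid_vertices 2 n) - Suc (2 * k' + 1))"
    unfolding total_cut_complex_eq
  proof (rule equicritical_tree_imp_wedge_of_spheres[OF finite_grid_vertices])
    show "equicritical_tree (grid_vertices 2 n) (grid_indep k) (2 * k' + 1) (n' choose k')"
      unfolding n' k' by (rule equicritical_tree_grid_2)
    show "2 * k' + 1 < card (grid_vertices 2 n)" using nk k' by (simp add: card)
    show "grid_indep k (grid_vertices 2 n)" using nk by (simp add: grid_indep_2)
  qed (rule has_indep_mono)
  then show "geometric_realization (total_cut_complex k (grid_vertices 2 n) grid_adj)
      homotopy_equivalent_space wedge_of_spheres ((n - 1) choose (k - 1)) (2 * n - 2 * k)"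
    unfolding card by (simp add: n' k')
next
  fix n :: nat
  assume n: "2 \<le> n"
  then obtain n' where n': "n = Suc n'" by (metis Suc_le_D numeral_2_eq_2)
  have card: "card (grid_vertices 3 n) = 3 * n" by (simp add: grid_vertices_def)
  have "geometric_realization (total_cut_complex 3 (grid_vertices 3 n) grid_adj)
      homotopy_equivalent_space wedge_of_spheres (2 * n' choose 2) (card (grid_vertices 3 n) - Suc 5)"
    unfolding total_cut_complex_eq
  proof (rule equicritical_tree_imp_wedge_of_spheres[OF finite_grid_vertices])
    show "equicritical_tree (grid_vertices 3 n) (grid_indep 3) 5 (2 * n' choose 2)"
      unfolding n' by (rule equicritical_tree_grid_3_3)
    show "5 < card (grid_vertices 3 n)" using n by (simp add: card)
    show "grid_indep 3 (grid_vertices 3 n)"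
      by (rule has_indepI[of "{(1, 1), (3, 1), (2, 2)}"]) (use n in \<open>auto simp: grid_adj_def grid_vertices_def\<close>)
  qed (rule has_indep_mono)
  moreover have "2 * n' = 2 * n - 2" using n' by simp
  ultimately show "geometric_realization (total_cut_complex 3 (grid_vertices 3 n) grid_adj)
      homotopy_equivalent_space wedge_of_spheres ((2 * n - 2) choose 2) (3 * n - 6)"
    by (simp add: card)
qed

end
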